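(* Let $d\ge 2$ and let $A=(A_{klj})_{k,l,j=1}^d$ be a tristochastic permutation tensor, i.e. $A_{klj}\in\{0,1\}$ and $\sum_k A_{klj}=\sum_l A_{klj}=\sum_j A_{klj}=1$ for all values of the remaining indices. For each $k\in\{1,\dots,d\}$ let $\{|a_{k,l}\rangle\}_{l=1}^d$ be an orthonormal basis of $\mathbb{C}^d$. Define the operator $U$ on $\mathbb{C}^d\otimes\mathbb{C}^d$ by its matrix elements $\langle k,i|U|l,j\rangle = U_{ki,lj}=A_{klj}\,(a_{k,l})_i$, where $(a_{k,l})_i=\langle i|a_{k,l}\rangle$ (this $U$ is unitary), and the channel $\Phi_A(\rho_1\otimes\rho_2)=\mathrm{Tr}_2[U(\rho_1\otimes\rho_2)U^\dagger]$. Then $U$ has maximal entangling power, $e_p(U)=1$, if and only if $\Phi_A$ is a quantum tristochastic channel.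
   Context: Entangling power: for a unitary $U$ on $\mathbb{C}^d\otimes\mathbb{C}^d$, $e_p(U)=\frac{d+1}{d-1}\,\mathbb{E}_{|\psi_A\rangle,|\psi_B\rangle}\big[\mathcal{E}(U(|\psi_A\rangle\otimes|\psi_B\rangle))\big]$, where the average is over independent Haar-random pure states on each factor and $\mathcal{E}(|\psi\rangle)=1-\mathrm{Tr}\rho_A^2$ with $\rho_A=\mathrm{Tr}_B|\psi\rangle\langle\psi|$ is the linear entropy of entanglement; $e_p\in[0,1]$. Dynamical matrix of $\Phi_A$: the operator $D$ on $\mathbb{C}^d\otimes\mathbb{C}^d\otimes\mathbb{C}^d$ with $\langle k,l,j|D|k',l',j'\rangle=\sum_i U_{ki,lj}\overline{U_{k'i,l'j'}}$, so that $\Phi_A(\rho_2\otimes\rho_3)=\mathrm{Tr}_{2,3}[D(\mathbb{I}\otimes\rho_2^\top\otimes\rho_3^\top)]$. The channel is called quantum tristochastic if, in addition, the maps $\rho_1\otimes\rho_2\mapsto \mathrm{Tr}_{1,3}[D(\rho_1^\top\otimes\mathbb{I}\otimes\rho_2^\top)]$ and $\rho_1\otimes\rho_2\mapsto\mathrm{Tr}_{1,2}[D(\rho_1^\top\otimes\rho_2^\top\otimes\mathbb{I})]$ (for density matrices $\rho_1,\rho_2$ on $\mathbb{C}^d$) are also valid quantum channels (completely positive and trace preserving). *)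

theory Defs
  imports "HOL-Analysis.Analysis"
begin

text \<open>Conventions: indices range over 0..d-1. Vectors in C^d are functions nat => complex
(only values below d matter). An operator on C^d (x) C^d is given by its matrix elements
U k i l j = <k,i|U|l,j>.\<close>

definition tristochastic_perm_tensor :: "nat \<Rightarrow> (nat \<Rightarrow> nat \<Rightarrow> nat \<Rightarrow> nat) \<Rightarrow> bool" where
  "tristochastic_perm_tensor d A \<longleftrightarrow>
     (\<forall>k<d. \<forall>l<d. \<forall>j<d. A k l j \<in> {0,1}) \<and>
     (\<forall>l<d. \<forall>j<d. (\<Sum>k<d. A k l j) = 1) \<and>
     (\<forall>k<d. \<forall>j<d. (\<Sum>l<d. A k l j) = 1) \<and>
     (\<forall>k<d. \<forall>l<d. (\<Sum>j<d. A k l j) = 1)"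

text \<open>a k l i = i-th component of the vector a_{k,l}; for each k, (a k l)_{l<d} is orthonormal
(hence an orthonormal basis of C^d).\<close>
definition orthonormal_bases :: "nat \<Rightarrow> (nat \<Rightarrow> nat \<Rightarrow> nat \<Rightarrow> complex) \<Rightarrow> bool" where
  "orthonormal_bases d a \<longleftrightarrow>
     (\<forall>k<d. \<forall>l<d. \<forall>l'<d. (\<Sum>i<d. cnj (a k l i) * a k l' i) = (if l = l' then 1 else 0))"

definition U_of :: "(nat \<Rightarrow> nat \<Rightarrow> nat \<Rightarrow> nat) \<Rightarrow> (nat \<Rightarrow> nat \<Rightarrow> nat \<Rightarrow> complex)
                    \<Rightarrow> nat \<Rightarrow> nat \<Rightarrow> nat \<Rightarrow> nat \<Rightarrow> complex" where
  "U_of A a k i l j = of_nat (A k l j) * a k l i"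

definition apply_prod :: "nat \<Rightarrow> (nat \<Rightarrow> nat \<Rightarrow> nat \<Rightarrow> nat \<Rightarrow> complex)
     \<Rightarrow> (nat \<Rightarrow> complex) \<Rightarrow> (nat \<Rightarrow> complex) \<Rightarrow> nat \<Rightarrow> nat \<Rightarrow> complex" where
  "apply_prod d U psiA psiB k i = (\<Sum>l<d. \<Sum>j<d. U k i l j * psiA l * psiB j)"

definition reduced_A :: "nat \<Rightarrow> (nat \<Rightarrow> nat \<Rightarrow> complex) \<Rightarrow> nat \<Rightarrow> nat \<Rightarrow> complex" where
  "reduced_A d phi k k' = (\<Sum>i<d. phi k i * cnj (phi k' i))"

definition lin_ent :: "nat \<Rightarrow> (nat \<Rightarrow> nat \<Rightarrow> complex) \<Rightarrow> real" where
  "lin_ent d phi = 1 - Re (\<Sum>k<d. \<Sum>k'<d. reduced_A d phi k k' * reduced_A d phi k' k)"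

text \<open>Haar-random pure state on C^d, realised as a normalised standard complex Gaussian vector
(its law is the unitarily invariant probability measure on the unit sphere).\<close>
definition cgauss :: "complex measure" where
  "cgauss = density lborel (\<lambda>z. ennreal (exp (- (cmod z)\<^sup>2) / pi))"

definition gauss_vec :: "nat \<Rightarrow> (nat \<Rightarrow> complex) measure" where
  "gauss_vec d = PiM {..<d} (\<lambda>_. cgauss)"

definition normalize_vec :: "nat \<Rightarrow> (nat \<Rightarrow> complex) \<Rightarrow> nat \<Rightarrow> complex" where
  "normalize_vec d g = (\<lambda>i. g i / complex_of_real (sqrt (\<Sum>m<d. (cmod (g m))\<^sup>2)))"

definition haar_avg :: "nat \<Rightarrow> ((nat \<Rightarrow> complex) \<Rightarrow> real) \<Rightarrow> real" where
  "haar_avg d f = (\<integral>g. f (normalize_vec d g) \<partial>gauss_vec d)"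

definition entangling_power :: "nat \<Rightarrow> (nat \<Rightarrow> nat \<Rightarrow> nat \<Rightarrow> nat \<Rightarrow> complex) \<Rightarrow> real" where
  "entangling_power d U =
     (real d + 1) / (real d - 1) *
       haar_avg d (\<lambda>psiA. haar_avg d (\<lambda>psiB. lin_ent d (apply_prod d U psiA psiB)))"

text \<open>Dynamical matrix: dyn d U k l j k' l' j' = <k,l,j|D|k',l',j'>.\<close>
definition dyn :: "nat \<Rightarrow> (nat \<Rightarrow> nat \<Rightarrow> nat \<Rightarrow> nat \<Rightarrow> complex)
     \<Rightarrow> nat \<Rightarrow> nat \<Rightarrow> nat \<Rightarrow> nat \<Rightarrow> nat \<Rightarrow> nat \<Rightarrow> complex" where
  "dyn d U k l j k' l' j' = (\<Sum>i<d. U k i l j * cnj (U k' i l' j'))"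

definition psd_on :: "'i set \<Rightarrow> ('i \<Rightarrow> 'i \<Rightarrow> complex) \<Rightarrow> bool" where
  "psd_on I X \<longleftrightarrow> (\<forall>v. let q = (\<Sum>x\<in>I. \<Sum>y\<in>I. cnj (v x) * X x y * v y) in Im q = 0 \<and> Re q \<ge> 0)"

definition completely_positive :: "nat \<Rightarrow> (((nat \<times> nat) \<Rightarrow> (nat \<times> nat) \<Rightarrow> complex) \<Rightarrow> nat \<Rightarrow> nat \<Rightarrow> complex) \<Rightarrow> bool" where
  "completely_positive d Psi \<longleftrightarrow>
     (\<forall>n::nat. \<forall>Y :: (nat \<times> (nat \<times> nat)) \<Rightarrow> (nat \<times> (nat \<times> nat)) \<Rightarrow> complex.
        psd_on ({..<n} \<times> ({..<d} \<times> {..<d})) Y \<longrightarrow>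
        psd_on ({..<n} \<times> {..<d})
          (\<lambda>(b, o1) (b', o2). Psi (\<lambda>x x'. Y (b, x) (b', x')) o1 o2))"

definition trace_preserving :: "nat \<Rightarrow> (((nat \<times> nat) \<Rightarrow> (nat \<times> nat) \<Rightarrow> complex) \<Rightarrow> nat \<Rightarrow> nat \<Rightarrow> complex) \<Rightarrow> bool" where
  "trace_preserving d Psi \<longleftrightarrow>
     (\<forall>X. (\<Sum>o1<d. Psi X o1 o1) = (\<Sum>x\<in>{..<d} \<times> {..<d}. X x x))"

definition quantum_channel where
  "quantum_channel d Psi \<longleftrightarrow> completely_positive d Psi \<and> trace_preserving d Psi"

text \<open>Linear extensions of the three maps defined by D (output at position 1, 2, 3).
E.g. chan2: rho1 (x) rho2 |-> Tr_{1,3}[D (rho1^T (x) I (x) rho2^T)].\<close>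
definition chan1 where
  "chan1 d D X k k' = (\<Sum>l<d. \<Sum>l'<d. \<Sum>j<d. \<Sum>j'<d. D k l j k' l' j' * X (l, j) (l', j'))"
definition chan2 where
  "chan2 d D X l l' = (\<Sum>k<d. \<Sum>k'<d. \<Sum>j<d. \<Sum>j'<d. D k l j k' l' j' * X (k, j) (k', j'))"
definition chan3 where
  "chan3 d D X j j' = (\<Sum>k<d. \<Sum>k'<d. \<Sum>l<d. \<Sum>l'<d. D k l j k' l' j' * X (k, l) (k', l'))"

definition quantum_tristochastic :: "nat \<Rightarrow> (nat \<Rightarrow> nat \<Rightarrow> nat \<Rightarrow> nat \<Rightarrow> nat \<Rightarrow> nat \<Rightarrow> complex) \<Rightarrow> bool" where
  "quantum_tristochastic d D \<longleftrightarrow>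
     quantum_channel d (chan1 d D) \<and> quantum_channel d (chan2 d D) \<and> quantum_channel d (chan3 d D)"

end

theory Submission
  imports Defs "HOL-Probability.Probability"
begin

text \<open>
  For a Haar-random \<open>\<psi>\<close> the fourth moments are
  \<open>E[\<psi>\<^sub>l \<psi>\<^sub>l\<^sub>'* \<psi>\<^sub>m* \<psi>\<^sub>m\<^sub>'] = (\<delta>\<^sub>l\<^sub>l\<^sub>' \<delta>\<^sub>m\<^sub>m\<^sub>' + \<delta>\<^sub>l\<^sub>m \<delta>\<^sub>l\<^sub>'\<^sub>m\<^sub>') / (d (d + 1))\<close>: multiplying one
  coordinate by the imaginary unit kills the unbalanced ones, a rotation of two coordinates by the
  angle of the 3-4-5 triangle forces \<open>E|\<psi>\<^sub>i|\<^sup>4 = 2 E|\<psi>\<^sub>i|\<^sup>2|\<psi>\<^sub>j|\<^sup>2\<close>, and normalisation fixes the constant.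
  Averaging first over one factor and then over the other expresses the mean purity as a sum of
  squared moduli: those of the entries of \<open>Tr\<^sub>2\<^sub>3 D\<close> and of \<open>D\<close>, which together contribute
  \<open>2 d\<^sup>3\<close>, and those of the entries of the partial traces \<open>Tr\<^sub>2 D\<close> and \<open>Tr\<^sub>3 D\<close>. Each of these
  partial traces has identity diagonal blocks, hence contributes at least \<open>d\<^sup>2\<close>, with equality iff it
  is the identity, i.e. iff the corresponding map is trace preserving. Since \<open>D\<close> is a Gram matrix,
  complete positivity is automatic, and \<open>e\<^sub>p = 1\<close> is exactly the case of two equalities.
\<close>

section \<open>Symmetries of the Gaussian vector\<close>

lemma sets_cgauss [simp, measurable_cong]: "sets cgauss = sets borel"
  by (simp add: cgauss_def)

lemma space_cgauss [simp]: "space cgauss = UNIV"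
  by (simp add: cgauss_def)

lemma prob_space_cgauss: "prob_space cgauss"
proof
  let ?n = "\<lambda>x::real. exp (- x\<^sup>2) / sqrt pi"
  \<comment> \<open>Standard deviation \<open>1 / sqrt 2\<close> makes the real density
    \<open>exp (- x^2) / sqrt pi\<close>; the complex density is the product of two of these, one
    each for real and imaginary part.\<close>
  have nd: "normal_density 0 (1 / sqrt 2) = ?n"
    by (auto simp: normal_density_def fun_eq_iff real_sqrt_mult power_divide)
  have one: "(\<integral>\<^sup>+x. ennreal (?n x) \<partial>lborel) = 1"
    using prob_space.emeasure_space_1[OF prob_space_normal_density[of "1 / sqrt 2" 0]]
    by (simp add: emeasure_density nd)
  have "ennreal (exp (- (cmod z)\<^sup>2) / pi) = (\<Prod>b\<in>Basis. ennreal (?n (z \<bullet> b)))" for z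
    by (simp add: Basis_complex_def cmod_power2 ennreal_mult'[symmetric] mult_exp_exp)
  then have "emeasure cgauss (space cgauss) =
      (\<integral>\<^sup>+z. (\<Prod>b\<in>Basis. ennreal (?n (z \<bullet> b))) \<partial>(lborel :: complex measure))"
    unfolding cgauss_def by (simp add: emeasure_density)
  also have "\<dots> = 1"
    by (subst nn_integral_lborel_prod) (auto simp: one)
  finally show "emeasure cgauss (space cgauss) = 1" .
qed

section \<open>Rotation invariance of Lebesgue measure on pairs\<close>

lemma nn_integral_lborel_shift:
  fixes f :: "'a::euclidean_space \<Rightarrow> ennreal"
  assumes [measurable]: "f \<in> borel_measurable borel"
  shows "(\<integral>\<^sup>+x. f (x + c) \<partial>lborel) = (\<integral>\<^sup>+x. f x \<partial>lborel)"
proof -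
  have "(\<integral>\<^sup>+x. f x \<partial>lborel) = (\<integral>\<^sup>+x. f x \<partial>distr lborel borel ((+) c))"
    by (simp only: lborel_distr_plus)
  then show ?thesis
    by (simp add: nn_integral_distr add.commute)
qed

lemma nn_integral_lborel_shear_snd:
  fixes f :: "complex \<times> complex \<Rightarrow> ennreal"
  assumes [measurable]: "f \<in> borel_measurable (borel \<Otimes>\<^sub>M borel)"
  shows "(\<integral>\<^sup>+z. \<integral>\<^sup>+w. f (z, w + t * z) \<partial>lborel \<partial>lborel) = (\<integral>\<^sup>+z. \<integral>\<^sup>+w. f (z, w) \<partial>lborel \<partial>lborel)"
  by (intro nn_integral_cong nn_integral_lborel_shift) measurable

lemma nn_integral_lborel_shear_fst:
  fixes f :: "complex \<times> complex \<Rightarrow> ennreal"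
  assumes [measurable]: "f \<in> borel_measurable (borel \<Otimes>\<^sub>M borel)"
  shows "(\<integral>\<^sup>+z. \<integral>\<^sup>+w. f (z + t * w, w) \<partial>lborel \<partial>lborel) = (\<integral>\<^sup>+z. \<integral>\<^sup>+w. f (z, w) \<partial>lborel \<partial>lborel)"
proof -
  have swap: "(\<integral>\<^sup>+z. \<integral>\<^sup>+w. g (z, w) \<partial>lborel \<partial>lborel) = (\<integral>\<^sup>+w. \<integral>\<^sup>+z. g (z, w) \<partial>lborel \<partial>lborel)"
    if [measurable]: "g \<in> borel_measurable (borel \<Otimes>\<^sub>M borel)" for g :: "complex \<times> complex \<Rightarrow> ennreal"
    by (rule lborel_pair.Fubini') measurable
  have "(\<integral>\<^sup>+z. \<integral>\<^sup>+w. f (z + t * w, w) \<partial>lborel \<partial>lborel) = (\<integral>\<^sup>+w. \<integral>\<^sup>+z. f (z + t * w, w) \<partial>lborel \<partial>lborel)"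
    using swap[of "\<lambda>(z, w). f (z + t * w, w)"] by simp
  also have "\<dots> = (\<integral>\<^sup>+w. \<integral>\<^sup>+z. f (z, w) \<partial>lborel \<partial>lborel)"
    by (intro nn_integral_cong nn_integral_lborel_shift) measurable
  finally show ?thesis
    by (simp add: swap)
qed

text \<open>The rotation is a product of three shears, and a shear preserves Lebesgue measure by Fubini and
  translation invariance.\<close>

lemma nn_integral_lborel_rotate:
  fixes f :: "complex \<times> complex \<Rightarrow> ennreal"
  assumes [measurable]: "f \<in> borel_measurable (borel \<Otimes>\<^sub>M borel)"
  shows "(\<integral>\<^sup>+z. \<integral>\<^sup>+w. f (3/5 * z - 4/5 * w, 4/5 * z + 3/5 * w) \<partial>lborel \<partial>lborel) =
         (\<integral>\<^sup>+z. \<integral>\<^sup>+w. f (z, w) \<partial>lborel \<partial>lborel)"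
proof -
  \<comment> \<open>For the angle with cosine 3/5 and sine 4/5, \<open>?t\<close> is the sine and
    \<open>?s\<close> is minus the tangent of the half angle, (4/5) / (1 + 3/5) = 1/2.\<close>
  let ?s = "- (1/2) :: complex" and ?t = "4/5 :: complex"
  define f1 where "f1 = (\<lambda>(z, w). f (z + ?s * w, w))"
  define f2 where "f2 = (\<lambda>(z, w). f1 (z, w + ?t * z))"
  have [measurable]: "f1 \<in> borel_measurable (borel \<Otimes>\<^sub>M borel)"
    unfolding f1_def by measurable
  have [measurable]: "f2 \<in> borel_measurable (borel \<Otimes>\<^sub>M borel)"
    unfolding f2_def by measurable
  have "f (3/5 * z - 4/5 * w, 4/5 * z + 3/5 * w) = f2 (z + ?s * w, w)" for z w
  proof -
    have "3/5 * z - 4/5 * w = z + ?s * w + ?s * (w + ?t * (z + ?s * w))"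
      and "4/5 * z + 3/5 * w = w + ?t * (z + ?s * w)"
      by (simp_all add: field_simps)
    then show ?thesis
      by (simp only: f1_def f2_def split_conv)
  qed
  then have "(\<integral>\<^sup>+z. \<integral>\<^sup>+w. f (3/5 * z - 4/5 * w, 4/5 * z + 3/5 * w) \<partial>lborel \<partial>lborel) =
      (\<integral>\<^sup>+z. \<integral>\<^sup>+w. f2 (z, w) \<partial>lborel \<partial>lborel)"
    by (simp only: nn_integral_lborel_shear_fst[OF \<open>f2 \<in> _\<close>])
  also have "\<dots> = (\<integral>\<^sup>+z. \<integral>\<^sup>+w. f1 (z, w) \<partial>lborel \<partial>lborel)"
    unfolding f2_def split_conv by (rule nn_integral_lborel_shear_snd) measurable
  also have "\<dots> = (\<integral>\<^sup>+z. \<integral>\<^sup>+w. f (z, w) \<partial>lborel \<partial>lborel)"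
    unfolding f1_def split_conv by (rule nn_integral_lborel_shear_fst) measurable
  finally show ?thesis .
qed

section \<open>Transfer to complex Gaussian variables\<close>

lemma nn_integral_cgauss:
  assumes [measurable]: "f \<in> borel_measurable borel"
  shows "(\<integral>\<^sup>+z. f z \<partial>cgauss) = (\<integral>\<^sup>+z. ennreal (exp (- (cmod z)\<^sup>2) / pi) * f z \<partial>lborel)"
  unfolding cgauss_def by (rule nn_integral_density) measurable

text \<open>The joint density depends only on |z|^2 + |w|^2. In this form a symmetry of Lebesgue
  measure that keeps this sum becomes a symmetry of the Gaussian pair.\<close>

lemma nn_integral_cgauss_pair:
  fixes h :: "complex \<times> complex \<Rightarrow> ennreal"
  assumes [measurable]: "h \<in> borel_measurable (borel \<Otimes>\<^sub>M borel)"
  shows "(\<integral>\<^sup>+z. \<integral>\<^sup>+w. h (z, w) \<partial>cgauss \<partial>cgauss) =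
    (\<integral>\<^sup>+z. \<integral>\<^sup>+w. ennreal (exp (- ((cmod z)\<^sup>2 + (cmod w)\<^sup>2)) / pi\<^sup>2) * h (z, w) \<partial>lborel \<partial>lborel)"
proof -
  have "(\<integral>\<^sup>+z. \<integral>\<^sup>+w. h (z, w) \<partial>cgauss \<partial>cgauss) =
    (\<integral>\<^sup>+z. ennreal (exp (- (cmod z)\<^sup>2) / pi) *
       (\<integral>\<^sup>+w. ennreal (exp (- (cmod w)\<^sup>2) / pi) * h (z, w) \<partial>lborel) \<partial>lborel)"
    by (simp add: nn_integral_cgauss)
  also have "\<dots> = (\<integral>\<^sup>+z. \<integral>\<^sup>+w. ennreal (exp (- (cmod z)\<^sup>2) / pi) *
       (ennreal (exp (- (cmod w)\<^sup>2) / pi) * h (z, w)) \<partial>lborel \<partial>lborel)"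
    by (subst nn_integral_cmult) auto
  also have "\<dots> = (\<integral>\<^sup>+z. \<integral>\<^sup>+w. ennreal (exp (- ((cmod z)\<^sup>2 + (cmod w)\<^sup>2)) / pi\<^sup>2) * h (z, w) \<partial>lborel \<partial>lborel)"
    by (intro nn_integral_cong)
      (simp add: mult.assoc[symmetric] ennreal_mult'[symmetric] exp_add[symmetric] power2_eq_square)
  finally show ?thesis .
qed

lemma cmod_rotate:
  "(cmod (3/5 * z - 4/5 * w))\<^sup>2 + (cmod (4/5 * z + 3/5 * w))\<^sup>2 = (cmod z)\<^sup>2 + (cmod w)\<^sup>2"
  unfolding cmod_power2 by (simp add: field_simps power2_eq_square)

lemma nn_integral_cgauss_rotate:
  fixes h :: "complex \<times> complex \<Rightarrow> ennreal"
  assumes [measurable]: "h \<in> borel_measurable (borel \<Otimes>\<^sub>M borel)"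
  shows "(\<integral>\<^sup>+z. \<integral>\<^sup>+w. h (3/5 * z - 4/5 * w, 4/5 * z + 3/5 * w) \<partial>cgauss \<partial>cgauss) =
         (\<integral>\<^sup>+z. \<integral>\<^sup>+w. h (z, w) \<partial>cgauss \<partial>cgauss)"
proof -
  let ?f = "\<lambda>(z, w). ennreal (exp (- ((cmod z)\<^sup>2 + (cmod w)\<^sup>2)) / pi\<^sup>2) * h (z, w)"
  have [measurable]: "?f \<in> borel_measurable (borel \<Otimes>\<^sub>M borel)"
    "(\<lambda>(z, w). h (3/5 * z - 4/5 * w, 4/5 * z + 3/5 * w)) \<in> borel_measurable (borel \<Otimes>\<^sub>M borel)"
    by measurable
  show ?thesis
    using nn_integral_lborel_rotate[of ?f]
      nn_integral_cgauss_pair[of "\<lambda>(z, w). h (3/5 * z - 4/5 * w, 4/5 * z + 3/5 * w)"]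
    by (simp only: nn_integral_cgauss_pair[OF assms] cmod_rotate split_conv) simp
qed

text \<open>Lebesgue measure is determined by its values on boxes, and a quarter turn maps boxes to
  boxes with the two side lengths exchanged.\<close>

lemma lborel_distr_mult_ii: "distr lborel borel ((*) \<i>) = (lborel :: complex measure)"
proof (rule lborel_eqI[symmetric])
  fix l u :: complex
  assume le: "\<And>b. b \<in> Basis \<Longrightarrow> l \<bullet> b \<le> u \<bullet> b"
  then have le': "Re l \<le> Re u" "Im l \<le> Im u"
    using le[of 1] le[of \<i>] by (simp_all add: Basis_complex_def)
  have "((*) \<i>) -` box l u = box (Complex (Im l) (- Re u)) (Complex (Im u) (- Re l))"
    by (auto simp: box_def Basis_complex_def)
  then have "emeasure (distr lborel borel ((*) \<i>)) (box l u) =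
      emeasure lborel (box (Complex (Im l) (- Re u)) (Complex (Im u) (- Re l)))"
    by (subst emeasure_distr) (auto simp: measurable_lborel1)
  also have "\<dots> = (\<Prod>b\<in>Basis. (u - l) \<bullet> b)"
    by (subst emeasure_lborel_box) (use le' in \<open>auto simp: Basis_complex_def mult.commute\<close>)
  finally show "emeasure (distr lborel borel ((*) \<i>)) (box l u) = (\<Prod>b\<in>Basis. (u - l) \<bullet> b)" .
qed simp

lemma nn_integral_cgauss_mult_ii:
  assumes [measurable]: "f \<in> borel_measurable borel"
  shows "(\<integral>\<^sup>+z. f (\<i> * z) \<partial>cgauss) = (\<integral>\<^sup>+z. f z \<partial>cgauss)"
proof -
  have "(\<integral>\<^sup>+z. f z \<partial>cgauss) =
     (\<integral>\<^sup>+z. ennreal (exp (- (cmod z)\<^sup>2) / pi) * f z \<partial>distr lborel borel ((*) \<i>))"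
    by (simp add: nn_integral_cgauss lborel_distr_mult_ii)
  also have "\<dots> = (\<integral>\<^sup>+z. ennreal (exp (- (cmod z)\<^sup>2) / pi) * f (\<i> * z) \<partial>lborel)"
    by (subst nn_integral_distr) (auto simp: norm_mult)
  finally show ?thesis
    by (simp add: nn_integral_cgauss)
qed

section \<open>From two coordinates to the whole Gaussian vector\<close>

lemma prob_space_gauss_vec: "prob_space (gauss_vec d)"
  unfolding gauss_vec_def by (intro prob_space_PiM prob_space_cgauss)

lemma pair_update_measurable:
  assumes ij: "i < d" "j < d" "i \<noteq> j"
    and [measurable]: "S \<in> borel_measurable (borel \<Otimes>\<^sub>M borel)" "T \<in> borel_measurable (borel \<Otimes>\<^sub>M borel)"
  shows "(\<lambda>g. g(i := S (g i, g j), j := T (g i, g j))) \<in> measurable (gauss_vec d) (gauss_vec d)"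
  unfolding gauss_vec_def
proof (rule measurable_PiM_single')
  fix k assume "k \<in> {..<d}"
  then show "(\<lambda>g. (g(i := S (g i, g j), j := T (g i, g j))) k) \<in> measurable (PiM {..<d} (\<lambda>_. cgauss)) cgauss"
    using ij by (cases "k = j"; cases "k = i") (simp_all, measurable)
qed (use ij in \<open>auto simp: space_PiM PiE_def extensional_def\<close>)

text \<open>Handles phase change and rotation at once. By Fubini the coordinates \<open>i\<close>
  and \<open>j\<close> are integrated innermost with all others frozen, where the invariance
  \<open>inv\<close> of the pair applies.\<close>

lemma gauss_vec_pair_invariant:
  assumes ij: "i < d" "j < d" "i \<noteq> j"
    and [measurable]: "S \<in> borel_measurable (borel \<Otimes>\<^sub>M borel)" "T \<in> borel_measurable (borel \<Otimes>\<^sub>M borel)"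
    and inv: "\<And>h :: complex \<times> complex \<Rightarrow> ennreal. h \<in> borel_measurable (borel \<Otimes>\<^sub>M borel) \<Longrightarrow>
      (\<integral>\<^sup>+z. \<integral>\<^sup>+w. h (S (z, w), T (z, w)) \<partial>cgauss \<partial>cgauss) = (\<integral>\<^sup>+z. \<integral>\<^sup>+w. h (z, w) \<partial>cgauss \<partial>cgauss)"
  shows "distr (gauss_vec d) (gauss_vec d) (\<lambda>g. g(i := S (g i, g j), j := T (g i, g j))) = gauss_vec d"
proof -
  interpret prob_space cgauss by (rule prob_space_cgauss)
  interpret product_sigma_finite "\<lambda>_::nat. cgauss" by standard
  define I where "I = {..<d} - {i, j}"
  have I: "finite I" "i \<notin> I" "j \<notin> insert i I" and eq: "{..<d} = insert j (insert i I)"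
    using ij by (auto simp: I_def)
  let ?P = "\<lambda>I. PiM I (\<lambda>_::nat. cgauss)"
  let ?R = "\<lambda>g::nat \<Rightarrow> complex. g(i := S (g i, g j), j := T (g i, g j))"
  have g: "gauss_vec d = ?P (insert j (insert i I))"
    by (simp add: gauss_vec_def eq)
  have [measurable]: "?R \<in> measurable (?P (insert j (insert i I))) (?P (insert j (insert i I)))"
    unfolding g[symmetric] by (rule pair_update_measurable) (use ij in measurable)
  have split: "(\<integral>\<^sup>+g. f g \<partial>?P (insert j (insert i I))) =
      (\<integral>\<^sup>+x. \<integral>\<^sup>+z. \<integral>\<^sup>+w. f (x(i := z, j := w)) \<partial>cgauss \<partial>cgauss \<partial>?P I)"
    if [measurable]: "f \<in> borel_measurable (?P (insert j (insert i I)))" for f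
    using I by (simp add: product_nn_integral_insert)
  show ?thesis unfolding g
  proof (rule measure_eqI)
    fix X assume "X \<in> sets (distr (?P (insert j (insert i I))) (?P (insert j (insert i I))) ?R)"
    then have [measurable]: "X \<in> sets (?P (insert j (insert i I)))" by simp
    let ?f = "indicator X :: _ \<Rightarrow> ennreal"
    have "emeasure (distr (?P (insert j (insert i I))) (?P (insert j (insert i I))) ?R) X =
       (\<integral>\<^sup>+g. ?f (?R g) \<partial>?P (insert j (insert i I)))"
      using nn_integral_distr[of ?R "?P (insert j (insert i I))" "?P (insert j (insert i I))" ?f]
      by simp
    also have "\<dots> = (\<integral>\<^sup>+x. \<integral>\<^sup>+z. \<integral>\<^sup>+w. ?f (x(i := S (z, w), j := T (z, w))) \<partial>cgauss \<partial>cgauss \<partial>?P I)"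
      using ij by (subst split) (simp_all add: fun_upd_twist)
    also have "\<dots> = (\<integral>\<^sup>+x. \<integral>\<^sup>+z. \<integral>\<^sup>+w. ?f (x(i := z, j := w)) \<partial>cgauss \<partial>cgauss \<partial>?P I)"
    proof (rule nn_integral_cong)
      fix x assume x: "x \<in> space (?P I)"
      have "(\<lambda>p. x(i := fst p, j := snd p)) \<in> measurable (borel \<Otimes>\<^sub>M borel) (?P (insert j (insert i I)))"
      proof (rule measurable_PiM_single')
        fix k assume "k \<in> insert j (insert i I)"
        then show "(\<lambda>p. (x(i := fst p, j := snd p)) k) \<in> measurable (borel \<Otimes>\<^sub>M borel) cgauss"
          by (cases "k = j"; cases "k = i") (simp_all, measurable)
      qed (use x in \<open>auto simp: space_PiM PiE_def extensional_def\<close>)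
      then have "(\<lambda>p. ?f (x(i := fst p, j := snd p))) \<in> borel_measurable (borel \<Otimes>\<^sub>M borel)"
        by measurable
      from inv[OF this]
      show "(\<integral>\<^sup>+z. \<integral>\<^sup>+w. ?f (x(i := S (z, w), j := T (z, w))) \<partial>cgauss \<partial>cgauss) =
            (\<integral>\<^sup>+z. \<integral>\<^sup>+w. ?f (x(i := z, j := w)) \<partial>cgauss \<partial>cgauss)"
        by simp
    qed
    also have "\<dots> = emeasure (?P (insert j (insert i I))) X"
      by (subst split[symmetric]) auto
    finally show "emeasure (distr (?P (insert j (insert i I))) (?P (insert j (insert i I))) ?R) X =
      emeasure (?P (insert j (insert i I))) X" .
  qed simp
qed

section \<open>Fourth moments of a Haar-random state\<close>

lemma normalize_vec_measurable [measurable]: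
  assumes "i < d"
  shows "(\<lambda>g. normalize_vec d g i) \<in> borel_measurable (gauss_vec d)"
proof -
  have [measurable]: "(\<lambda>g. g k) \<in> borel_measurable (gauss_vec d)" if "k < d" for k
    using that measurable_component_singleton[of k "{..<d}" "\<lambda>_. cgauss"]
    by (simp add: gauss_vec_def cong: measurable_cong_sets)
  show ?thesis
    unfolding normalize_vec_def using assms by measurable
qed

lemma sum_normalize_vec:
  assumes "(\<Sum>m<d. (cmod (g m))\<^sup>2) \<noteq> 0"
  shows "(\<Sum>m<d. (cmod (normalize_vec d g m))\<^sup>2) = 1"
  using assms
  by (simp add: normalize_vec_def norm_divide power_divide sum_nonneg sum_divide_distrib[symmetric])

lemma normalize_vec_le_1:
  assumes "i < d"
  shows "cmod (normalize_vec d g i) \<le> 1"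
proof (cases "(\<Sum>m<d. (cmod (g m))\<^sup>2) = 0")
  \<comment> \<open>All coordinates vanish and division by 0 gives 0, so the bound holds at every
    point and not only almost everywhere.\<close>
  case True
  then show ?thesis by (simp add: normalize_vec_def)
next
  case False
  have "(cmod (normalize_vec d g i))\<^sup>2 \<le> (\<Sum>m<d. (cmod (normalize_vec d g m))\<^sup>2)"
    using assms by (intro member_le_sum) auto
  then have "(cmod (normalize_vec d g i))\<^sup>2 \<le> 1"
    using sum_normalize_vec[OF False] by simp
  then show ?thesis
    by (simp add: abs_square_le_1)
qed

text \<open>The update leaves the norm unchanged and commutes with division by a scalar, so it makes
  no difference whether it is applied before or after normalising.\<close>

lemma normalize_vec_pair_update:
  assumes ij: "i < d" "j < d" "i \<noteq> j"
    and norm: "\<And>z w. (cmod (S (z, w)))\<^sup>2 + (cmod (T (z, w)))\<^sup>2 = (cmod z)\<^sup>2 + (cmod w)\<^sup>2"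
    and hom: "\<And>z w c. S (z / c, w / c) = S (z, w) / c" "\<And>z w c. T (z / c, w / c) = T (z, w) / c"
  defines "R \<equiv> \<lambda>g :: nat \<Rightarrow> complex. g(i := S (g i, g j), j := T (g i, g j))"
  shows "normalize_vec d (R g) = R (normalize_vec d g)"
proof -
  have *: "{..<d} = insert i (insert j ({..<d} - {i, j}))"
    using ij by auto
  have "(\<Sum>m<d. (cmod (R g m))\<^sup>2) = (\<Sum>m<d. (cmod (g m))\<^sup>2)"
    using ij norm[of "g i" "g j"] by (subst (1 2) *) (simp add: R_def)
  then show ?thesis
    by (simp add: normalize_vec_def R_def fun_eq_iff hom)
qed

text \<open>The symmetry of the Gaussian law passes to the normalised vector because
  \<open>R\<close> commutes with normalisation. The value type is general so that complex monomials
  and real moduli are both covered.\<close>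

lemma haar_pair_invariant:
  fixes f :: "(nat \<Rightarrow> complex) \<Rightarrow> 'b::{banach, second_countable_topology}"
  assumes ij: "i < d" "j < d" "i \<noteq> j"
    and ST: "S \<in> borel_measurable (borel \<Otimes>\<^sub>M borel)" "T \<in> borel_measurable (borel \<Otimes>\<^sub>M borel)"
    and inv: "\<And>h :: complex \<times> complex \<Rightarrow> ennreal. h \<in> borel_measurable (borel \<Otimes>\<^sub>M borel) \<Longrightarrow>
      (\<integral>\<^sup>+z. \<integral>\<^sup>+w. h (S (z, w), T (z, w)) \<partial>cgauss \<partial>cgauss) = (\<integral>\<^sup>+z. \<integral>\<^sup>+w. h (z, w) \<partial>cgauss \<partial>cgauss)"
    and norm: "\<And>z w. (cmod (S (z, w)))\<^sup>2 + (cmod (T (z, w)))\<^sup>2 = (cmod z)\<^sup>2 + (cmod w)\<^sup>2"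
    and hom: "\<And>z w c. S (z / c, w / c) = S (z, w) / c" "\<And>z w c. T (z / c, w / c) = T (z, w) / c"
    and f: "(\<lambda>g. f (normalize_vec d g)) \<in> borel_measurable (gauss_vec d)"
  defines "R \<equiv> \<lambda>g :: nat \<Rightarrow> complex. g(i := S (g i, g j), j := T (g i, g j))"
  shows "(\<integral>g. f (normalize_vec d g) \<partial>gauss_vec d) = (\<integral>g. f (R (normalize_vec d g)) \<partial>gauss_vec d)"
proof -
  note D = gauss_vec_pair_invariant[OF ij ST inv, folded R_def]
  have R: "R \<in> measurable (gauss_vec d) (gauss_vec d)"
    unfolding R_def using pair_update_measurable[OF ij ST] .
  have "(\<integral>g. f (normalize_vec d g) \<partial>gauss_vec d) =
        (\<integral>g. f (normalize_vec d g) \<partial>distr (gauss_vec d) (gauss_vec d) R)"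
    by (simp only: D)
  also have "\<dots> = (\<integral>g. f (normalize_vec d (R g)) \<partial>gauss_vec d)"
    by (rule integral_distr[OF R f])
  finally show ?thesis
    unfolding R_def using normalize_vec_pair_update[OF ij norm hom] by simp
qed

lemma haar_phase:
  fixes f :: "(nat \<Rightarrow> complex) \<Rightarrow> 'b::{banach, second_countable_topology}"
  assumes "2 \<le> d" "c < d"
    and f: "(\<lambda>g. f (normalize_vec d g)) \<in> borel_measurable (gauss_vec d)"
  shows "(\<integral>g. f (normalize_vec d g) \<partial>gauss_vec d) =
    (\<integral>g. f ((normalize_vec d g)(c := \<i> * normalize_vec d g c)) \<partial>gauss_vec d)"
proof -
  \<comment> \<open>A partner coordinate that the update leaves fixed, so that the result on pairs
    applies; it exists because \<open>d\<close> is at least 2.\<close>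
  define j where "j = (if c = 0 then 1 else 0 :: nat)"
  have j: "j < d" "c \<noteq> j"
    using assms by (auto simp: j_def)
  interpret prob_space cgauss by (rule prob_space_cgauss)
  have inv: "(\<integral>\<^sup>+z. \<integral>\<^sup>+w. h (\<i> * z, w) \<partial>cgauss \<partial>cgauss) = (\<integral>\<^sup>+z. \<integral>\<^sup>+w. h (z, w) \<partial>cgauss \<partial>cgauss)"
    if [measurable]: "h \<in> borel_measurable (borel \<Otimes>\<^sub>M borel)" for h :: "complex \<times> complex \<Rightarrow> ennreal"
    by (rule nn_integral_cgauss_mult_ii[of "\<lambda>z. \<integral>\<^sup>+w. h (z, w) \<partial>cgauss"]) measurable
  have "(\<integral>g. f (normalize_vec d g) \<partial>gauss_vec d) =
     (\<integral>g. f ((normalize_vec d g)(c := (\<lambda>p. \<i> * fst p) (normalize_vec d g c, normalize_vec d g j),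
               j := snd (normalize_vec d g c, normalize_vec d g j))) \<partial>gauss_vec d)"
    by (rule haar_pair_invariant)
      (use assms j inv in \<open>auto simp: norm_mult\<close>)
  also have "\<dots> = (\<integral>g. f ((normalize_vec d g)(c := \<i> * normalize_vec d g c)) \<partial>gauss_vec d)"
    using j by (intro Bochner_Integration.integral_cong refl arg_cong[of _ _ f]) auto
  finally show ?thesis .
qed

lemma haar_rotate:
  fixes f :: "complex \<Rightarrow> complex \<Rightarrow> 'b::{banach, second_countable_topology}"
  assumes ij: "i < d" "j < d" "i \<noteq> j"
    and [measurable]: "case_prod f \<in> borel_measurable (borel \<Otimes>\<^sub>M borel)"
  shows "(\<integral>g. f (normalize_vec d g i) (normalize_vec d g j) \<partial>gauss_vec d) =
    (\<integral>g. f (3/5 * normalize_vec d g i - 4/5 * normalize_vec d g j)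
           (4/5 * normalize_vec d g i + 3/5 * normalize_vec d g j) \<partial>gauss_vec d)"
proof -
  have [measurable]: "(\<lambda>g. f (normalize_vec d g i) (normalize_vec d g j)) \<in> borel_measurable (gauss_vec d)"
    using ij by measurable
  let ?S = "\<lambda>(z, w). 3/5 * z - 4/5 * w :: complex" and ?T = "\<lambda>(z, w). 4/5 * z + 3/5 * w :: complex"
  have S: "?S (z / c, w / c) = ?S (z, w) / c" and T: "?T (z / c, w / c) = ?T (z, w) / c" for z w c
    by (simp_all add: diff_divide_distrib add_divide_distrib mult.commute)
  have "(\<integral>g. f (normalize_vec d g i) (normalize_vec d g j) \<partial>gauss_vec d) =
     (\<integral>g. (\<lambda>p. f (p i) (p j)) ((normalize_vec d g)
        (i := ?S (normalize_vec d g i, normalize_vec d g j),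
         j := ?T (normalize_vec d g i, normalize_vec d g j))) \<partial>gauss_vec d)"
  proof (rule haar_pair_invariant[OF ij])
    show "(\<integral>\<^sup>+z. \<integral>\<^sup>+w. h (?S (z, w), ?T (z, w)) \<partial>cgauss \<partial>cgauss) = (\<integral>\<^sup>+z. \<integral>\<^sup>+w. h (z, w) \<partial>cgauss \<partial>cgauss)"
      if "h \<in> borel_measurable (borel \<Otimes>\<^sub>M borel)" for h :: "complex \<times> complex \<Rightarrow> ennreal"
      unfolding split_conv by (rule nn_integral_cgauss_rotate[OF that])
    show "(cmod (?S (z, w)))\<^sup>2 + (cmod (?T (z, w)))\<^sup>2 = (cmod z)\<^sup>2 + (cmod w)\<^sup>2" for z w
      unfolding split_conv by (rule cmod_rotate)
  qed (use S T in \<open>simp_all only:\<close>, measurable)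
  then show ?thesis
    using ij by simp
qed

text \<open>The entry (\<open>l\<close>, \<open>l'\<close>) of the projector onto \<open>p\<close>
  times the conjugate of its entry (\<open>m\<close>, \<open>m'\<close>): the monomials that arise
  when the squared modulus of a sesquilinear form in \<open>p\<close> is expanded.\<close>

definition quartic :: "nat \<Rightarrow> nat \<Rightarrow> nat \<Rightarrow> nat \<Rightarrow> (nat \<Rightarrow> complex) \<Rightarrow> complex" where
  "quartic l l' m m' p = p l * cnj (p l') * cnj (p m) * p m'"

lemma quartic_measurable [measurable]:
  assumes "l < d" "l' < d" "m < d" "m' < d"
  shows "(\<lambda>g. quartic l l' m m' (normalize_vec d g)) \<in> borel_measurable (gauss_vec d)"
proof -
  have [measurable]: "(\<lambda>g. cnj (normalize_vec d g i)) \<in> borel_measurable (gauss_vec d)" if "i < d" for i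
    using that by (intro borel_measurable_continuous_on[of cnj] normalize_vec_measurable continuous_intros)
  show ?thesis
    unfolding quartic_def using assms by measurable
qed

lemma integrable_quartic:
  assumes "l < d" "l' < d" "m < d" "m' < d"
  shows "integrable (gauss_vec d) (\<lambda>g. quartic l l' m m' (normalize_vec d g))"
proof -
  interpret prob_space "gauss_vec d" by (rule prob_space_gauss_vec)
  show ?thesis
  proof (rule integrable_const_bound[where B = 1])
    show "AE g in gauss_vec d. cmod (quartic l l' m m' (normalize_vec d g)) \<le> 1"
      using assms
      by (intro always_eventually allI)
        (simp add: quartic_def norm_mult mult_le_one normalize_vec_le_1)
  qed (use assms in measurable)
qed

lemma haar_quartic_eq_0:
  assumes "2 \<le> d" "l < d" "l' < d" "m < d" "m' < d"
    and "\<not> (l = l' \<and> m = m')" "\<not> (l = m \<and> l' = m')"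
  shows "(\<integral>g. quartic l l' m m' (normalize_vec d g) \<partial>gauss_vec d) = 0"
proof -
  \<comment> \<open>The index \<open>c\<close> is chosen so that its phase does not cancel: the
    factor \<open>f\<close> picked up by the monomial is -i in the first two cases and i or -1 in
    the last.\<close>
  define c where "c = (if l = l' then m else if l = m then l' else l)"
  define u where "u = (\<lambda>k. if k = c then \<i> else 1)"
  define f where "f = u l * cnj (u l') * cnj (u m) * u m'"
  have "c < d"
    using assms by (auto simp: c_def)
  have "f \<noteq> 1"
    using assms(6-7) by (auto simp: f_def u_def c_def complex_eq_iff)
  have "quartic l l' m m' (p(c := \<i> * p c)) = f * quartic l l' m m' p" for p
    by (simp add: quartic_def f_def u_def)
  then have "(\<integral>g. quartic l l' m m' (normalize_vec d g) \<partial>gauss_vec d) =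
     f * (\<integral>g. quartic l l' m m' (normalize_vec d g) \<partial>gauss_vec d)"
    using haar_phase[OF assms(1) \<open>c < d\<close>, of "quartic l l' m m'"] assms(2-5) by simp
  with \<open>f \<noteq> 1\<close> show ?thesis
    by simp
qed

definition haar_mom :: "nat \<Rightarrow> nat \<Rightarrow> nat \<Rightarrow> real" where
  "haar_mom d i j = (\<integral>g. (cmod (normalize_vec d g i))\<^sup>2 * (cmod (normalize_vec d g j))\<^sup>2 \<partial>gauss_vec d)"

lemma quartic_diag: "quartic i i j j p = of_real ((cmod (p i))\<^sup>2 * (cmod (p j))\<^sup>2)"
  "quartic i j i j p = of_real ((cmod (p i))\<^sup>2 * (cmod (p j))\<^sup>2)"
  by (simp_all only: quartic_def of_real_mult complex_norm_square mult_ac)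

lemma integrable_haar_mom:
  assumes "i < d" "j < d"
  shows "integrable (gauss_vec d) (\<lambda>g. (cmod (normalize_vec d g i))\<^sup>2 * (cmod (normalize_vec d g j))\<^sup>2)"
  using integrable_Re[OF integrable_quartic[of i d i j j]] assms by (simp add: quartic_diag)

lemma haar_mom_diag:
  assumes "i < d" "j < d"
  shows "(\<integral>g. quartic i i j j (normalize_vec d g) \<partial>gauss_vec d) = of_real (haar_mom d i j)"
    "(\<integral>g. quartic i j i j (normalize_vec d g) \<partial>gauss_vec d) = of_real (haar_mom d i j)"
  by (simp_all only: quartic_diag haar_mom_def integral_complex_of_real)

text \<open>The last three terms are written as unfolded instances of \<open>quartic\<close> with
  unbalanced indices when \<open>x\<close> and \<open>y\<close> are distinct coordinates, so they
  will average to 0.\<close>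

lemma cmod_comb_power4:
  fixes x y :: complex and c s :: real
  shows "(cmod (c * x + s * y))\<^sup>2 * (cmod (c * x + s * y))\<^sup>2 =
    c^4 * ((cmod x)\<^sup>2 * (cmod x)\<^sup>2) + s^4 * ((cmod y)\<^sup>2 * (cmod y)\<^sup>2)
    + 4 * c\<^sup>2 * s\<^sup>2 * ((cmod x)\<^sup>2 * (cmod y)\<^sup>2)
    + 2 * c\<^sup>2 * s\<^sup>2 * Re (x * cnj y * cnj y * x)
    + 4 * c^3 * s * Re (x * cnj x * cnj y * x) + 4 * c * s^3 * Re (x * cnj y * cnj y * y)"
  unfolding cmod_power2 by (simp add: algebra_simps power2_eq_square power3_eq_cube power4_eq_xxxx)

lemma haar_mom_comb:
  fixes c s :: real
  assumes d: "2 \<le> d" and ij: "i < d" "j < d" "i \<noteq> j"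
  shows "(\<integral>g. (cmod (c * normalize_vec d g i + s * normalize_vec d g j))\<^sup>2 *
              (cmod (c * normalize_vec d g i + s * normalize_vec d g j))\<^sup>2 \<partial>gauss_vec d)
    = c^4 * haar_mom d i i + s^4 * haar_mom d j j + 4 * c\<^sup>2 * s\<^sup>2 * haar_mom d i j"
proof -
  note q = quartic_def[symmetric, where p = "normalize_vec d _"]
  have zero: "(\<integral>g. Re (quartic a b e f (normalize_vec d g)) \<partial>gauss_vec d) = 0"
    if "a < d" "b < d" "e < d" "f < d" "\<not> (a = b \<and> e = f)" "\<not> (a = e \<and> b = f)" for a b e f
    using integral_Re[OF integrable_quartic, of a d b e f] haar_quartic_eq_0[of d a b e f] d that
    by simp
  \<comment> \<open>Linearity for exactly six summands, so that its integrability premises match the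
    six terms of the expansion.\<close>
  have lin: "(\<integral>g. a1 * f1 g + a2 * f2 g + a3 * f3 g + a4 * f4 g + a5 * f5 g + a6 * f6 g \<partial>M) =
      a1 * integral\<^sup>L M f1 + a2 * integral\<^sup>L M f2 + a3 * integral\<^sup>L M f3 +
      a4 * integral\<^sup>L M f4 + a5 * integral\<^sup>L M f5 + a6 * integral\<^sup>L M f6"
    if "integrable M f1" "integrable M f2" "integrable M f3" "integrable M f4" "integrable M f5" "integrable M f6"
    for M and a1 a2 a3 a4 a5 a6 :: real and f1 f2 f3 f4 f5 f6 :: "(nat \<Rightarrow> complex) \<Rightarrow> real"
    using that by simp
  have "(\<integral>g. (cmod (c * normalize_vec d g i + s * normalize_vec d g j))\<^sup>2 *
              (cmod (c * normalize_vec d g i + s * normalize_vec d g j))\<^sup>2 \<partial>gauss_vec d)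
    = c^4 * haar_mom d i i + s^4 * haar_mom d j j + 4 * c\<^sup>2 * s\<^sup>2 * haar_mom d i j
     + 2 * c\<^sup>2 * s\<^sup>2 * (\<integral>g. Re (quartic i j j i (normalize_vec d g)) \<partial>gauss_vec d)
     + 4 * c^3 * s * (\<integral>g. Re (quartic i i j i (normalize_vec d g)) \<partial>gauss_vec d)
     + 4 * c * s^3 * (\<integral>g. Re (quartic i j j j (normalize_vec d g)) \<partial>gauss_vec d)"
    unfolding cmod_comb_power4 q haar_mom_def
    by (intro lin integrable_haar_mom integrable_Re integrable_quartic ij)
  then show ?thesis
    using ij by (simp add: zero)
qed

text \<open>Rotating the fourth power of either coordinate gives two linear equations for three
  moments. Their difference equates the two diagonal moments, and then either equation yields the
  ratio 2.\<close>

lemma haar_mom_rel: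
  assumes d: "2 \<le> d" and ij: "i < d" "j < d" "i \<noteq> j"
  shows "haar_mom d i i = haar_mom d j j" "haar_mom d i i = 2 * haar_mom d i j"
proof -
  have "haar_mom d i i = (3/5)^4 * haar_mom d i i + (-4/5)^4 * haar_mom d j j + 4 * (3/5)\<^sup>2 * (-4/5)\<^sup>2 * haar_mom d i j"
    using haar_rotate[OF ij, of "\<lambda>x y. (cmod x)\<^sup>2 * (cmod x)\<^sup>2"] haar_mom_comb[OF d ij, of "3/5" "-4/5"]
    by (simp add: haar_mom_def)
  moreover have "haar_mom d j j = (4/5)^4 * haar_mom d i i + (3/5)^4 * haar_mom d j j + 4 * (4/5)\<^sup>2 * (3/5)\<^sup>2 * haar_mom d i j"
    using haar_rotate[OF ij, of "\<lambda>x y. (cmod y)\<^sup>2 * (cmod y)\<^sup>2"] haar_mom_comb[OF d ij, of "4/5" "3/5"]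
    by (simp add: haar_mom_def)
  ultimately show "haar_mom d i i = haar_mom d j j" "haar_mom d i i = 2 * haar_mom d i j"
    by (simp_all add: power2_eq_square power4_eq_xxxx)
qed

text \<open>One coordinate alone vanishes with probability 0, points being Lebesgue null; hence
  normalisation fails only on a null set.\<close>

lemma AE_gauss_vec_nonzero:
  assumes "0 < d"
  shows "AE g in gauss_vec d. (\<Sum>m<d. (cmod (g m))\<^sup>2) \<noteq> 0"
proof -
  have "AE z in cgauss. z \<noteq> 0"
    unfolding cgauss_def
    by (subst AE_density) (use AE_lborel_singleton[of "0::complex"] in auto)
  then have "AE g in gauss_vec d. g 0 \<noteq> 0"
    unfolding gauss_vec_def using assms
    by (intro AE_PiM_component[where P = "\<lambda>z. z \<noteq> 0"] prob_space_cgauss) auto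
  then show ?thesis
    by eventually_elim (use assms in \<open>auto simp: sum_nonneg_eq_0_iff\<close>)
qed

lemma sum_haar_mom:
  assumes "0 < d"
  shows "(\<Sum>i<d. \<Sum>j<d. haar_mom d i j) = 1"
proof -
  interpret prob_space "gauss_vec d" by (rule prob_space_gauss_vec)
  have "(\<Sum>i<d. \<Sum>j<d. haar_mom d i j) =
    (\<integral>g. (\<Sum>i<d. \<Sum>j<d. (cmod (normalize_vec d g i))\<^sup>2 * (cmod (normalize_vec d g j))\<^sup>2) \<partial>gauss_vec d)"
    unfolding haar_mom_def
    by (intro has_bochner_integral_integral_eq[symmetric] has_bochner_integral_sum
        has_bochner_integral_integrable integrable_haar_mom) auto
  also have "\<dots> = (\<integral>g. 1 \<partial>gauss_vec d)"
  proof (rule integral_cong_AE)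
    \<comment> \<open>The double sum factors as the square of the squared norm, which is 1 almost
      surely.\<close>
    show "AE g in gauss_vec d. (\<Sum>i<d. \<Sum>j<d. (cmod (normalize_vec d g i))\<^sup>2 * (cmod (normalize_vec d g j))\<^sup>2) = 1"
      using AE_gauss_vec_nonzero[OF assms]
      by eventually_elim (simp add: sum_product[symmetric] sum_normalize_vec)
  qed measurable
  finally show ?thesis
    by (simp add: prob_space)
qed

lemma haar_mom_eq:
  assumes d: "2 \<le> d" and ij: "i < d" "j < d"
  shows "haar_mom d i j = (if i = j then 2 else 1) / (real d * (real d + 1))"
proof -
  define x where "x = haar_mom d 0 0"
  have diag: "haar_mom d k k = x" if "k < d" for k
    using haar_mom_rel(1)[OF d, of k 0] that d by (cases "k = 0") (auto simp: x_def)
  \<comment> \<open>Writing every moment as \<open>x / 2\<close>, plus another \<open>x / 2\<close>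
    on the diagonal, makes the total (d^2 + d) x / 2, which must be 1.\<close>
  have mom: "haar_mom d k l = (if k = l then x else 0) / 2 + x / 2" if "k < d" "l < d" for k l
    using haar_mom_rel(2)[OF d, of k l] diag that by auto
  have "1 = (\<Sum>k<d. \<Sum>l<d. (if k = l then x else 0) / 2 + x / 2)"
    by (subst sum_haar_mom[of d, symmetric]) (use d mom in \<open>auto intro!: sum.cong\<close>)
  also have "\<dots> = real d * (real d + 1) * x / 2"
    by (simp add: sum.distrib sum_divide_distrib[symmetric] field_simps)
  finally have "x * (real d * (real d + 1)) = 2"
    by (simp add: mult_ac)
  then have "x = 2 / (real d * (real d + 1))"
    using d by (subst nonzero_eq_divide_eq) auto
  then show ?thesis
    using mom[OF ij] by simp
qed

lemma haar_quartic:
  assumes "2 \<le> d" "l < d" "l' < d" "m < d" "m' < d"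
  shows "(\<integral>g. quartic l l' m m' (normalize_vec d g) \<partial>gauss_vec d) =
    of_real (((if l = l' \<and> m = m' then 1 else 0) + (if l = m \<and> l' = m' then 1 else 0)) / (real d * (real d + 1)))"
proof -
  \<comment> \<open>Four equal indices fall under the first case; both indicators are then 1, which
    is the factor 2 of the diagonal moment.\<close>
  consider "l = l'" "m = m'" | "l = m" "l' = m'" "l \<noteq> l'" | "\<not> (l = l' \<and> m = m')" "\<not> (l = m \<and> l' = m')"
    by blast
  then show ?thesis
    by cases (use assms in \<open>auto simp: haar_mom_diag haar_mom_eq haar_quartic_eq_0\<close>)
qed

section \<open>Mean purity and the dynamical matrix\<close>

text \<open>The two index pairings in \<open>haar_quartic\<close> produce the squared modulus of the
  trace of \<open>R\<close> and its squared Hilbert-Schmidt norm. Both Haar averages in the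
  entangling power are of this kind.\<close>

lemma haar_sesquilinear_square:
  fixes R :: "nat \<Rightarrow> nat \<Rightarrow> complex"
  assumes d: "2 \<le> d"
  shows "has_bochner_integral (gauss_vec d)
    (\<lambda>g. (cmod (\<Sum>j<d. \<Sum>j'<d. R j j' * (normalize_vec d g j * cnj (normalize_vec d g j'))))\<^sup>2)
    (((cmod (\<Sum>j<d. R j j))\<^sup>2 + (\<Sum>j<d. \<Sum>j'<d. (cmod (R j j'))\<^sup>2)) / (real d * (real d + 1)))"
proof -
  let ?b = "1 / (real d * (real d + 1))"
  let ?e = "\<lambda>j j' n n'. complex_of_real (((if j = j' \<and> n = n' then 1 else 0) + (if j = n \<and> j' = n' then 1 else 0)) * ?b)"
  have expand: "complex_of_real ((cmod (\<Sum>j<d. \<Sum>j'<d. R j j' * (p j * cnj (p j'))))\<^sup>2) =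
     (\<Sum>j<d. \<Sum>n<d. \<Sum>j'<d. \<Sum>n'<d. R j j' * cnj (R n n') * quartic j j' n n' p)" for p
    unfolding complex_norm_square cnj_sum sum_product
    by (intro sum.cong refl) (simp add: quartic_def mult_ac)
  have "has_bochner_integral (gauss_vec d)
    (\<lambda>g. \<Sum>j<d. \<Sum>n<d. \<Sum>j'<d. \<Sum>n'<d. R j j' * cnj (R n n') * quartic j j' n n' (normalize_vec d g))
    (\<Sum>j<d. \<Sum>n<d. \<Sum>j'<d. \<Sum>n'<d. R j j' * cnj (R n n') * ?e j j' n n')"
    using d
    by (intro has_bochner_integral_sum has_bochner_integral_mult_right)
      (auto simp: has_bochner_integral_iff integrable_quartic haar_quartic)
  also have "(\<Sum>j<d. \<Sum>n<d. \<Sum>j'<d. \<Sum>n'<d. R j j' * cnj (R n n') * ?e j j' n n') =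
     of_real ?b * ((\<Sum>j<d. \<Sum>n<d. \<Sum>j'<d. \<Sum>n'<d. if j = j' \<and> n = n' then R j j' * cnj (R n n') else 0)
       + (\<Sum>j<d. \<Sum>n<d. \<Sum>j'<d. \<Sum>n'<d. if j = n \<and> j' = n' then R j j' * cnj (R n n') else 0))"
    unfolding sum.distrib[symmetric] sum_distrib_left
    by (intro sum.cong refl) auto
  also have "(\<Sum>j<d. \<Sum>n<d. \<Sum>j'<d. \<Sum>n'<d. if j = j' \<and> n = n' then R j j' * cnj (R n n') else 0) =
     (\<Sum>j<d. \<Sum>n<d. R j j * cnj (R n n))"
  proof (intro sum.cong refl)
    fix j n assume "j \<in> {..<d}" "n \<in> {..<d}"
    then have "(\<Sum>j'<d. \<Sum>n'<d. if j = j' \<and> n = n' then R j j' * cnj (R n n') else 0) =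
      (\<Sum>j'<d. if j = j' then R j j' * cnj (R n n) else 0)"
      by (intro sum.cong refl) auto
    then show "(\<Sum>j'<d. \<Sum>n'<d. if j = j' \<and> n = n' then R j j' * cnj (R n n') else 0) = R j j * cnj (R n n)"
      using \<open>j \<in> {..<d}\<close> by simp
  qed
  also have "\<dots> = of_real ((cmod (\<Sum>j<d. R j j))\<^sup>2)"
    by (simp only: complex_norm_square cnj_sum sum_product)
  also have "(\<Sum>j<d. \<Sum>n<d. \<Sum>j'<d. \<Sum>n'<d. if j = n \<and> j' = n' then R j j' * cnj (R n n') else 0) =
     (\<Sum>j<d. \<Sum>n<d. if j = n then \<Sum>j'<d. R j j' * cnj (R n j') else 0)"
    by (intro sum.cong refl) (auto intro!: sum.cong)
  also have "\<dots> = of_real (\<Sum>j<d. \<Sum>j'<d. (cmod (R j j'))\<^sup>2)"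
    by (simp only: of_real_sum complex_norm_square) (simp add: sum.delta)
  finally have "has_bochner_integral (gauss_vec d)
      (\<lambda>g. complex_of_real ((cmod (\<Sum>j<d. \<Sum>j'<d. R j j' * (normalize_vec d g j * cnj (normalize_vec d g j'))))\<^sup>2))
      (of_real (?b * ((cmod (\<Sum>j<d. R j j))\<^sup>2 + (\<Sum>j<d. \<Sum>j'<d. (cmod (R j j'))\<^sup>2))))"
    by (simp only: expand of_real_mult of_real_add)
  from has_bochner_integral_Re[OF this] show ?thesis
    by (simp add: Re_complex_of_real del: of_real_sum of_real_power of_real_mult of_real_add)
qed

text \<open>Inner product of two vectors linear in the same \<open>x\<close>, rewritten as a
  sesquilinear form with Gram coefficients. It serves the reduced state as well as the identities
  for orthonormal bases.\<close>

lemma sum_mult_cnj_sum: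
  fixes x :: "nat \<Rightarrow> complex"
  shows "(\<Sum>i<d. (\<Sum>l<e. a i l * x l) * cnj (\<Sum>l<e. b i l * x l)) =
    (\<Sum>l<e. \<Sum>l'<e. (\<Sum>i<d. a i l * cnj (b i l')) * (x l * cnj (x l')))"
proof -
  have "(\<Sum>i<d. (\<Sum>l<e. a i l * x l) * cnj (\<Sum>l<e. b i l * x l)) =
     (\<Sum>i<d. \<Sum>l<e. \<Sum>l'<e. a i l * cnj (b i l') * (x l * cnj (x l')))"
    by (simp add: sum_product mult_ac)
  also have "\<dots> = (\<Sum>l<e. \<Sum>i<d. \<Sum>l'<e. a i l * cnj (b i l') * (x l * cnj (x l')))"
    by (rule sum.swap)
  also have "\<dots> = (\<Sum>l<e. \<Sum>l'<e. \<Sum>i<d. a i l * cnj (b i l') * (x l * cnj (x l')))"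
    by (intro sum.cong refl sum.swap)
  finally show ?thesis
    by (simp add: sum_distrib_right)
qed

text \<open>The nesting is deliberate: a sesquilinear form in \<open>chi\<close> whose coefficients
  are sesquilinear forms in \<open>psi\<close>, ready for averaging over \<open>chi\<close> first
  and \<open>psi\<close> second.\<close>

lemma reduced_A_apply_prod:
  "reduced_A d (apply_prod d U psi chi) k k' =
    (\<Sum>j<d. \<Sum>j'<d. (\<Sum>l<d. \<Sum>l'<d. dyn d U k l j k' l' j' * (psi l * cnj (psi l'))) * (chi j * cnj (chi j')))"
proof -
  have "apply_prod d U psi chi = (\<lambda>k i. \<Sum>j<d. (\<Sum>l<d. U k i l j * psi l) * chi j)"
    unfolding apply_prod_def fun_eq_iff by (subst sum.swap) (simp add: sum_distrib_right)
  then show ?thesis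
    by (simp only: reduced_A_def sum_mult_cnj_sum dyn_def)
qed

text \<open>The reduced state is Hermitian, so its purity is its squared Hilbert-Schmidt
  norm.\<close>

lemma lin_ent_eq: "lin_ent d phi = 1 - (\<Sum>k<d. \<Sum>k'<d. (cmod (reduced_A d phi k k'))\<^sup>2)"
proof -
  have herm: "reduced_A d phi k' k = cnj (reduced_A d phi k k')" for k k'
    by (simp add: reduced_A_def mult.commute)
  have "reduced_A d phi k k' * reduced_A d phi k' k = of_real ((cmod (reduced_A d phi k k'))\<^sup>2)" for k k'
    unfolding complex_norm_square herm[of k' k] ..
  then show ?thesis
    by (simp add: lin_ent_def)
qed

lemma haar_avg_one_minus:
  assumes "has_bochner_integral (gauss_vec d) (\<lambda>g. f (normalize_vec d g)) x"
  shows "haar_avg d (\<lambda>p. 1 - f p) = 1 - x"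
proof -
  interpret prob_space "gauss_vec d" by (rule prob_space_gauss_vec)
  show ?thesis
    unfolding haar_avg_def using assms by (simp add: has_bochner_integral_iff prob_space)
qed

text \<open>Partial trace over the output slot of \<open>chan2\<close>, an operator on slots 1 and
  3; \<open>ptrace3\<close> is its analogue for \<open>chan3\<close>.\<close>

definition ptrace2 :: "nat \<Rightarrow> (nat \<Rightarrow> nat \<Rightarrow> nat \<Rightarrow> nat \<Rightarrow> nat \<Rightarrow> nat \<Rightarrow> complex) \<Rightarrow> nat \<Rightarrow> nat \<Rightarrow> nat \<Rightarrow> nat \<Rightarrow> complex" where
  "ptrace2 d D k j k' j' = (\<Sum>l<d. D k l j k' l j')"

definition ptrace3 :: "nat \<Rightarrow> (nat \<Rightarrow> nat \<Rightarrow> nat \<Rightarrow> nat \<Rightarrow> nat \<Rightarrow> nat \<Rightarrow> complex) \<Rightarrow> nat \<Rightarrow> nat \<Rightarrow> nat \<Rightarrow> nat \<Rightarrow> complex" where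
  "ptrace3 d D k l k' l' = (\<Sum>j<d. D k l j k' l' j)"

lemma entangling_power_eq:
  fixes U :: "nat \<Rightarrow> nat \<Rightarrow> nat \<Rightarrow> nat \<Rightarrow> complex"
  assumes d: "2 \<le> d"
  defines "D \<equiv> dyn d U"
  shows "entangling_power d U = (real d + 1) / (real d - 1) *
    (1 - (\<Sum>k<d. \<Sum>k'<d. (cmod (\<Sum>l<d. ptrace3 d D k l k' l))\<^sup>2
           + (\<Sum>l<d. \<Sum>l'<d. (cmod (ptrace3 d D k l k' l'))\<^sup>2)
           + (\<Sum>j<d. \<Sum>j'<d. (cmod (ptrace2 d D k j k' j'))\<^sup>2
           + (\<Sum>l<d. \<Sum>l'<d. (cmod (D k l j k' l' j'))\<^sup>2))) / (real d * (real d + 1))\<^sup>2)"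
proof -
  let ?N = "real d * (real d + 1)"
  let ?s = "\<lambda>M p. \<Sum>l<d. \<Sum>l'<d. M l l' * (p l * cnj (p l'))"
  let ?F = "\<lambda>p. \<Sum>k<d. \<Sum>k'<d. ((cmod (?s (\<lambda>l l'. ptrace3 d D k l k' l') p))\<^sup>2
      + (\<Sum>j<d. \<Sum>j'<d. (cmod (?s (\<lambda>l l'. D k l j k' l' j') p))\<^sup>2)) / ?N"
  \<comment> \<open>The trace part of the average over \<open>chi\<close> is again a sesquilinear
    form in \<open>psi\<close>, with coefficients from \<open>ptrace3\<close>.\<close>
  have tr: "(\<Sum>j<d. ?s (\<lambda>l l'. D k l j k' l' j) p) = ?s (\<lambda>l l'. ptrace3 d D k l k' l') p" for k k' p
  proof -
    have "(\<Sum>j<d. ?s (\<lambda>l l'. D k l j k' l' j) p) = (\<Sum>l<d. \<Sum>j<d. \<Sum>l'<d. D k l j k' l' j * (p l * cnj (p l')))"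
      by (rule sum.swap)
    also have "\<dots> = (\<Sum>l<d. \<Sum>l'<d. \<Sum>j<d. D k l j k' l' j * (p l * cnj (p l')))"
      by (intro sum.cong refl sum.swap)
    finally show ?thesis
      by (simp add: ptrace3_def sum_distrib_right)
  qed
  have inner: "haar_avg d (\<lambda>chi. lin_ent d (apply_prod d U psi chi)) = 1 - ?F psi" for psi
    unfolding lin_ent_eq reduced_A_apply_prod D_def[symmetric] tr[symmetric]
    by (intro haar_avg_one_minus has_bochner_integral_sum haar_sesquilinear_square d)
  \<comment> \<open>The average over \<open>psi\<close> splits each of the two squared moduli inside
    \<open>?F\<close> once more into a trace and a norm part, which gives the four kinds of
    summands.\<close>
  have "haar_avg d (\<lambda>psi. 1 - ?F psi) =
    1 - (\<Sum>k<d. \<Sum>k'<d. (((cmod (\<Sum>l<d. ptrace3 d D k l k' l))\<^sup>2 + (\<Sum>l<d. \<Sum>l'<d. (cmod (ptrace3 d D k l k' l'))\<^sup>2)) / ?N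
       + (\<Sum>j<d. \<Sum>j'<d. ((cmod (\<Sum>l<d. D k l j k' l j'))\<^sup>2 + (\<Sum>l<d. \<Sum>l'<d. (cmod (D k l j k' l' j'))\<^sup>2)) / ?N)) / ?N)"
    by (intro haar_avg_one_minus has_bochner_integral_sum has_bochner_integral_divide
        has_bochner_integral_add haar_sesquilinear_square d)
  also have "\<dots> = 1 - (\<Sum>k<d. \<Sum>k'<d. (cmod (\<Sum>l<d. ptrace3 d D k l k' l))\<^sup>2
           + (\<Sum>l<d. \<Sum>l'<d. (cmod (ptrace3 d D k l k' l'))\<^sup>2)
           + (\<Sum>j<d. \<Sum>j'<d. (cmod (ptrace2 d D k j k' j'))\<^sup>2
           + (\<Sum>l<d. \<Sum>l'<d. (cmod (D k l j k' l' j'))\<^sup>2))) / ?N\<^sup>2"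
    by (simp only: ptrace2_def sum_divide_distrib[symmetric] add_divide_distrib[symmetric]
        divide_divide_eq_left power2_eq_square)
  finally show ?thesis
    by (simp only: entangling_power_def inner)
qed

section \<open>Channels given by a dynamical matrix\<close>

text \<open>The three maps differ only in the slot of \<open>D\<close> that serves as output, so
  permuting slots reduces every question to \<open>chan1\<close>.\<close>

lemma chan2_eq_chan1: "chan2 d D = chan1 d (\<lambda>l k j l' k' j'. D k l j k' l' j')"
  by (simp add: fun_eq_iff chan1_def chan2_def)

lemma chan3_eq_chan1: "chan3 d D = chan1 d (\<lambda>j k l j' k' l'. D k l j k' l' j')"
  by (simp add: fun_eq_iff chan1_def chan3_def)

lemma sum_swap_last4:
  "(\<Sum>i\<in>I. \<Sum>p\<in>A. \<Sum>q\<in>B. \<Sum>r\<in>C. \<Sum>s\<in>E. t i p q r s) =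
   (\<Sum>p\<in>A. \<Sum>q\<in>B. \<Sum>r\<in>C. \<Sum>s\<in>E. \<Sum>i\<in>I. t i p q r s)"
  unfolding sum.cartesian_product
  by (rule sum.reindex_bij_witness
      [where i = "\<lambda>(p, q, r, s, i). (i, p, q, r, s)" and j = "\<lambda>(i, p, q, r, s). (p, q, r, s, i)"]) auto

lemma trace_chan1:
  fixes K :: "nat \<Rightarrow> nat \<Rightarrow> nat \<Rightarrow> nat \<Rightarrow> nat \<Rightarrow> nat \<Rightarrow> complex"
  shows "(\<Sum>o1<d. chan1 d K X o1 o1) =
    (\<Sum>p<d. \<Sum>p'<d. \<Sum>q<d. \<Sum>q'<d. (\<Sum>o1<d. K o1 p q o1 p' q') * X (p, q) (p', q'))"
  unfolding chan1_def by (subst sum_swap_last4) (simp only: sum_distrib_right)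

text \<open>The output trace is a linear functional of the input whose coefficients form the partial
  trace of \<open>K\<close> over the output slot; it is the trace exactly when these are the entries
  of the identity.\<close>

lemma trace_preserving_chan1_iff:
  "trace_preserving d (chan1 d K) \<longleftrightarrow>
    (\<forall>p<d. \<forall>q<d. \<forall>p'<d. \<forall>q'<d. (\<Sum>o1<d. K o1 p q o1 p' q') = (if p = p' \<and> q = q' then 1 else 0))"
  (is "?L \<longleftrightarrow> ?R")
proof
  assume ?L
  show ?R
  proof (intro allI impI)
    fix p q p' q' assume lt: "p < d" "q < d" "p' < d" "q' < d"
    \<comment> \<open>This matrix unit reads off a single coefficient.\<close>
    define X where "X = (\<lambda>x y. if x = (p, q) \<and> y = (p', q') then 1 else 0 :: complex)"
    have "(\<Sum>o1<d. chan1 d K X o1 o1) = (\<Sum>o1<d. K o1 p q o1 p' q')"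
    proof -
      have "(\<Sum>q0<d. \<Sum>q1<d. (\<Sum>o1<d. K o1 p0 q0 o1 p1 q1) * X (p0, q0) (p1, q1)) =
          (if p0 = p \<and> p1 = p' then \<Sum>o1<d. K o1 p q o1 p' q' else 0)" for p0 p1
      proof -
        have "(\<Sum>q0<d. \<Sum>q1<d. (\<Sum>o1<d. K o1 p0 q0 o1 p1 q1) * X (p0, q0) (p1, q1)) =
          (\<Sum>q0<d. if q0 = q then if p0 = p \<and> p1 = p' then \<Sum>o1<d. K o1 p q o1 p' q' else 0 else 0)"
          using lt by (intro sum.cong refl) (auto simp: X_def if_distrib[of "(*) _"] cong: if_cong)
        then show ?thesis
          using lt by simp
      qed
      then have "(\<Sum>o1<d. chan1 d K X o1 o1) =
         (\<Sum>p0<d. \<Sum>p1<d. if p0 = p \<and> p1 = p' then \<Sum>o1<d. K o1 p q o1 p' q' else 0)"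
        by (simp add: trace_chan1)
      also have "\<dots> = (\<Sum>p0<d. if p0 = p then \<Sum>o1<d. K o1 p q o1 p' q' else 0)"
        using lt by (intro sum.cong refl) auto
      finally show ?thesis
        using lt by simp
    qed
    moreover have "(\<Sum>x\<in>{..<d} \<times> {..<d}. X x x) = (if p = p' \<and> q = q' then 1 else 0)"
    proof -
      have "(\<Sum>x\<in>{..<d} \<times> {..<d}. X x x) =
        (\<Sum>x\<in>{..<d} \<times> {..<d}. if x = (p, q) then if p = p' \<and> q = q' then 1 else 0 else 0)"
        by (intro sum.cong refl) (auto simp: X_def)
      then show ?thesis
        using lt by (simp add: sum.delta)
    qed
    ultimately show "(\<Sum>o1<d. K o1 p q o1 p' q') = (if p = p' \<and> q = q' then 1 else 0)"
      using \<open>?L\<close> by (simp add: trace_preserving_def)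
  qed
next
  assume R: ?R
  show ?L
    unfolding trace_preserving_def
  proof
    fix X :: "nat \<times> nat \<Rightarrow> nat \<times> nat \<Rightarrow> complex"
    have "(\<Sum>o1<d. chan1 d K X o1 o1) =
      (\<Sum>p<d. \<Sum>p'<d. \<Sum>q<d. \<Sum>q'<d. if p = p' \<and> q = q' then X (p, q) (p', q') else 0)"
      unfolding trace_chan1 by (intro sum.cong refl) (use R in auto)
    also have "\<dots> = (\<Sum>p<d. \<Sum>p'<d. if p = p' then \<Sum>q<d. X (p, q) (p, q) else 0)"
      by (intro sum.cong refl) (auto intro!: sum.cong)
    also have "\<dots> = (\<Sum>x\<in>{..<d} \<times> {..<d}. X x x)"
      by (simp add: sum.cartesian_product')
    finally show "(\<Sum>o1<d. chan1 d K X o1 o1) = (\<Sum>x\<in>{..<d} \<times> {..<d}. X x x)" .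
  qed
qed

text \<open>Brings the Kraus index to the front and the output indices \<open>u\<close>,
  \<open>u'\<close> to the end, where the summand factors into a product of two sums.\<close>

lemma sum_swap_Kraus:
  "(\<Sum>b\<in>B. \<Sum>u\<in>A. \<Sum>b'\<in>B. \<Sum>u'\<in>A. \<Sum>p\<in>P. \<Sum>p'\<in>P. \<Sum>q\<in>P. \<Sum>q'\<in>P. \<Sum>i\<in>I. t i b u p q b' u' p' q') =
   (\<Sum>i\<in>I. \<Sum>b\<in>B. \<Sum>p\<in>P. \<Sum>q\<in>P. \<Sum>b'\<in>B. \<Sum>p'\<in>P. \<Sum>q'\<in>P. \<Sum>u\<in>A. \<Sum>u'\<in>A. t i b u p q b' u' p' q')"
  unfolding sum.cartesian_product
  by (rule sum.reindex_bij_witness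
      [where i = "\<lambda>(i, b, p, q, b', p', q', u, u'). (b, u, b', u', p, p', q, q', i)"
        and j = "\<lambda>(b, u, b', u', p, p', q, q', i). (i, b, p, q, b', p', q', u, u')"]) auto

text \<open>The \<open>V i\<close> act as Kraus operators: the quadratic form of the output is a sum
  over \<open>i\<close> of quadratic forms of the positive input \<open>Y\<close>.\<close>

lemma completely_positive_chan1:
  assumes K: "\<And>o1 p q o2 p' q'. K o1 p q o2 p' q' = (\<Sum>i<d. V i o1 p q * cnj (V i o2 p' q'))"
  shows "completely_positive d (chan1 d K)"
  unfolding completely_positive_def
proof (intro allI impI)
  fix n and Y :: "nat \<times> nat \<times> nat \<Rightarrow> nat \<times> nat \<times> nat \<Rightarrow> complex"
  assume Y: "psd_on ({..<n} \<times> {..<d} \<times> {..<d}) Y"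
  show "psd_on ({..<n} \<times> {..<d}) (\<lambda>(b, o1) (b', o2). chan1 d K (\<lambda>x x'. Y (b, x) (b', x')) o1 o2)"
    unfolding psd_on_def Let_def
  proof
    fix v :: "nat \<times> nat \<Rightarrow> complex"
    \<comment> \<open>The adjoint of \<open>V i\<close> applied to the system part of
      \<open>v\<close>, with the ancilla index \<open>b\<close> untouched.\<close>
    define w where "w = (\<lambda>i (b, p, q). \<Sum>u<d. cnj (V i u p q) * v (b, u))"
    define Q where "Q = (\<lambda>i. \<Sum>x\<in>{..<n} \<times> {..<d} \<times> {..<d}. \<Sum>y\<in>{..<n} \<times> {..<d} \<times> {..<d}.
        cnj (w i x) * Y x y * w i y)"
    have Q: "Im (Q i) = 0 \<and> 0 \<le> Re (Q i)" for i
      using Y unfolding psd_on_def Let_def Q_def by blast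
    let ?t = "\<lambda>i b u p q b' u' p' q'. cnj (v (b, u)) * V i u p q * Y (b, p, q) (b', p', q') * cnj (V i u' p' q') * v (b', u')"
    have "(\<Sum>x\<in>{..<n} \<times> {..<d}. \<Sum>y\<in>{..<n} \<times> {..<d}. cnj (v x) *
        (\<lambda>(b, o1) (b', o2). chan1 d K (\<lambda>x x'. Y (b, x) (b', x')) o1 o2) x y * v y) =
      (\<Sum>b<n. \<Sum>u<d. \<Sum>b'<n. \<Sum>u'<d. \<Sum>p<d. \<Sum>p'<d. \<Sum>q<d. \<Sum>q'<d. \<Sum>i<d. ?t i b u p q b' u' p' q')"
      unfolding sum.cartesian_product' split_conv chan1_def K sum_distrib_left sum_distrib_right
      by (intro sum.cong refl) (simp only: mult_ac)
    also have "\<dots> = (\<Sum>i<d. \<Sum>b<n. \<Sum>p<d. \<Sum>q<d. \<Sum>b'<n. \<Sum>p'<d. \<Sum>q'<d. \<Sum>u<d. \<Sum>u'<d. ?t i b u p q b' u' p' q')"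
      by (rule sum_swap_Kraus)
    also have "\<dots> = (\<Sum>i<d. Q i)"
    proof (intro sum.cong refl)
      fix i
      have "(\<Sum>u<d. \<Sum>u'<d. ?t i b u p q b' u' p' q') =
          cnj (w i (b, p, q)) * Y (b, p, q) (b', p', q') * w i (b', p', q')" for b p q b' p' q'
      proof -
        have "cnj (w i (b, p, q)) * Y (b, p, q) (b', p', q') * w i (b', p', q') =
            Y (b, p, q) (b', p', q') * ((\<Sum>u<d. V i u p q * cnj (v (b, u))) * (\<Sum>u<d. cnj (V i u p' q') * v (b', u)))"
          by (simp add: w_def)
        also have "\<dots> = (\<Sum>u<d. \<Sum>u'<d. ?t i b u p q b' u' p' q')"
          unfolding sum_product unfolding sum_distrib_left by (intro sum.cong refl) (simp only: mult_ac)
        finally show ?thesis ..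
      qed
      then show "(\<Sum>b<n. \<Sum>p<d. \<Sum>q<d. \<Sum>b'<n. \<Sum>p'<d. \<Sum>q'<d. \<Sum>u<d. \<Sum>u'<d. ?t i b u p q b' u' p' q') = Q i"
        by (simp only: Q_def sum.cartesian_product')
    qed
    finally show "Im (\<Sum>x\<in>{..<n} \<times> {..<d}. \<Sum>y\<in>{..<n} \<times> {..<d}. cnj (v x) *
        (\<lambda>(b, o1) (b', o2). chan1 d K (\<lambda>x x'. Y (b, x) (b', x')) o1 o2) x y * v y) = 0 \<and>
      0 \<le> Re (\<Sum>x\<in>{..<n} \<times> {..<d}. \<Sum>y\<in>{..<n} \<times> {..<d}. cnj (v x) *
        (\<lambda>(b, o1) (b', o2). chan1 d K (\<lambda>x x'. Y (b, x) (b', x')) o1 o2) x y * v y)"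
      using Q by (simp add: sum_nonneg)
  qed
qed

section \<open>Tristochastic permutation tensors\<close>

text \<open>Natural numbers with sum 1 are a single 1 among zeros.\<close>

lemma mult_of_sum_eq_1:
  fixes f :: "nat \<Rightarrow> nat"
  assumes "(\<Sum>k<d. f k) = 1" "x < d" "y < d"
  shows "f x * f y = (if x = y then f x else 0)"
proof (cases "x = y")
  case True
  have "f x \<le> 1"
    using member_le_sum[of x "{..<d}" f] assms by simp
  then show ?thesis
    using True by (cases "f x") auto
next
  case False
  have "(\<Sum>k\<in>{x, y}. f k) \<le> (\<Sum>k<d. f k)"
    using assms by (intro sum_mono2) auto
  then show ?thesis
    using False assms by (cases "f x"; cases "f y") auto
qed

text \<open>The matrix \<open>P = \<Sum>\<^sub>l |b\<^sub>l\<rangle>\<langle>b\<^sub>l|\<close> is a projection of trace \<open>d\<close>;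
  hence the Hilbert--Schmidt norm of \<open>1 - P\<close> vanishes.\<close>

lemma orthonormal_complete:
  fixes b :: "nat \<Rightarrow> nat \<Rightarrow> complex"
  assumes on: "\<And>l l'. l < d \<Longrightarrow> l' < d \<Longrightarrow> (\<Sum>i<d. cnj (b l i) * b l' i) = (if l = l' then 1 else 0)"
    and i: "i < d" "i' < d"
  shows "(\<Sum>l<d. b l i * cnj (b l i')) = (if i = i' then 1 else 0)"
proof -
  define P where "P = (\<lambda>i i'. \<Sum>l<d. b l i * cnj (b l i'))"
  define I where "I = (\<lambda>i i' :: nat. if i = i' then 1 else 0 :: complex)"
  have cnjI: "cnj (I i i') = I i i'" for i i'
    by (simp add: I_def)
  have sumI: "(\<Sum>i'<d. I i i' * f i') = f i" "(\<Sum>i'<d. f i' * I i i') = f i" if "i < d" for i f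
    using that by (simp_all add: I_def if_distrib[of "\<lambda>x. x * _"] if_distrib[of "\<lambda>x. _ * x"] cong: if_cong)
  have tr: "(\<Sum>i<d. P i i) = of_nat d"
  proof -
    have "(\<Sum>i<d. P i i) = (\<Sum>l<d. \<Sum>i<d. cnj (b l i) * b l i)"
      unfolding P_def by (subst sum.swap) (simp add: mult.commute)
    then show ?thesis by (simp add: on)
  qed
  \<comment> \<open>The diagonal of P P^* = P, which is all of the projection property that the norm
    computation uses.\<close>
  have proj: "(\<Sum>i'<d. P i i' * cnj (P i i')) = P i i" for i
  proof -
    have "(\<Sum>i'<d. P i i' * cnj (P i i')) =
      (\<Sum>i'<d. (\<Sum>l<d. cnj (b l i') * b l i) * cnj (\<Sum>l<d. cnj (b l i') * b l i))"
      by (simp only: P_def mult.commute)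
    also have "\<dots> = (\<Sum>l<d. \<Sum>l'<d. (\<Sum>i'<d. cnj (b l i') * cnj (cnj (b l' i'))) * (b l i * cnj (b l' i)))"
      by (rule sum_mult_cnj_sum)
    also have "\<dots> = (\<Sum>l<d. \<Sum>l'<d. (if l = l' then b l i * cnj (b l i) else 0))"
      by (intro sum.cong refl) (auto simp: on)
    finally show ?thesis
      by (simp add: P_def)
  qed
  have "complex_of_real (\<Sum>i<d. \<Sum>i'<d. (cmod (I i i' - P i i'))\<^sup>2) =
     (\<Sum>i<d. \<Sum>i'<d. (I i i' - P i i') * cnj (I i i' - P i i'))"
    by (simp only: of_real_sum complex_norm_square)
  also have "\<dots> = (\<Sum>i<d. (\<Sum>i'<d. I i i' * I i i') - (\<Sum>i'<d. I i i' * cnj (P i i'))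
      - (\<Sum>i'<d. P i i' * I i i') + (\<Sum>i'<d. P i i' * cnj (P i i')))"
    by (simp only: complex_cnj_diff cnjI left_diff_distrib right_diff_distrib sum_subtractf sum.distrib)
      (simp add: algebra_simps)
  also have "\<dots> = (\<Sum>i<d. 1 - cnj (P i i))"
    by (intro sum.cong refl) (simp add: sumI proj, simp add: I_def)
  also have "\<dots> = of_nat d - cnj (\<Sum>i<d. P i i)"
    by (simp add: sum_subtractf)
  finally have "complex_of_real (\<Sum>i<d. \<Sum>i'<d. (cmod (I i i' - P i i'))\<^sup>2) = 0"
    by (simp add: tr)
  then have "(\<Sum>i<d. \<Sum>i'<d. (cmod (I i i' - P i i'))\<^sup>2) = 0"
    by (simp only: of_real_eq_0_iff)
  then have "I i i' = P i i'"
    using i by (auto simp: sum_nonneg_eq_0_iff sum_nonneg)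
  then show ?thesis
    by (simp add: P_def I_def)
qed

text \<open>Expanding the squares leaves the sum of the projectors onto the basis vectors, which is
  the identity by completeness.\<close>

lemma orthonormal_Parseval:
  fixes b :: "nat \<Rightarrow> nat \<Rightarrow> complex"
  assumes on: "\<And>l l'. l < d \<Longrightarrow> l' < d \<Longrightarrow> (\<Sum>i<d. cnj (b l i) * b l' i) = (if l = l' then 1 else 0)"
  shows "(\<Sum>l<d. (cmod (\<Sum>i<d. b l i * cnj (v i)))\<^sup>2) = (\<Sum>i<d. (cmod (v i))\<^sup>2)"
proof -
  have "complex_of_real (\<Sum>l<d. (cmod (\<Sum>i<d. b l i * cnj (v i)))\<^sup>2) =
     (\<Sum>l<d. (\<Sum>i<d. b l i * cnj (v i)) * cnj (\<Sum>i<d. b l i * cnj (v i)))"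
    by (simp only: of_real_sum complex_norm_square)
  also have "\<dots> = (\<Sum>i<d. \<Sum>i'<d. (\<Sum>l<d. b l i * cnj (b l i')) * (cnj (v i) * cnj (cnj (v i'))))"
    by (rule sum_mult_cnj_sum)
  also have "\<dots> = (\<Sum>i<d. \<Sum>i'<d. if i = i' then v i * cnj (v i) else 0)"
    by (intro sum.cong refl) (auto simp: orthonormal_complete[OF on])
  also have "\<dots> = complex_of_real (\<Sum>i<d. (cmod (v i))\<^sup>2)"
    by (simp only: of_real_sum complex_norm_square) simp
  finally show ?thesis
    by (simp only: of_real_eq_iff)
qed

locale tristochastic_unitary =
  fixes d :: nat and A :: "nat \<Rightarrow> nat \<Rightarrow> nat \<Rightarrow> nat" and a :: "nat \<Rightarrow> nat \<Rightarrow> nat \<Rightarrow> complex"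
  assumes d: "2 \<le> d"
    and A: "tristochastic_perm_tensor d A"
    and a: "orthonormal_bases d a"
begin

text \<open>The inner products <a_{k',l'}|a_{k,l}>; for fixed \<open>k\<close> and \<open>k'\<close>
  below \<open>d\<close> they form the change-of-basis matrix between two of the given
  bases.\<close>

definition G :: "nat \<Rightarrow> nat \<Rightarrow> nat \<Rightarrow> nat \<Rightarrow> complex" where
  "G k l k' l' = (\<Sum>i<d. a k l i * cnj (a k' l' i))"

abbreviation D :: "nat \<Rightarrow> nat \<Rightarrow> nat \<Rightarrow> nat \<Rightarrow> nat \<Rightarrow> nat \<Rightarrow> complex" where
  "D \<equiv> dyn d (U_of A a)"

lemma D_eq: "D k l j k' l' j' = of_nat (A k l j * A k' l' j') * G k l k' l'"
  by (simp add: dyn_def U_of_def G_def sum_distrib_left mult_ac)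

lemma A_sum:
  "k < d \<Longrightarrow> l < d \<Longrightarrow> (\<Sum>j<d. A k l j) = 1"
  "k < d \<Longrightarrow> j < d \<Longrightarrow> (\<Sum>l<d. A k l j) = 1"
  "l < d \<Longrightarrow> j < d \<Longrightarrow> (\<Sum>k<d. A k l j) = 1"
  using A by (auto simp: tristochastic_perm_tensor_def)

lemma A_mult:
  assumes "k < d" "l < d" "j < d"
  shows "j' < d \<Longrightarrow> A k l j * A k l j' = (if j = j' then A k l j else 0)"
    "l' < d \<Longrightarrow> A k l j * A k l' j = (if l = l' then A k l j else 0)"
    "k' < d \<Longrightarrow> A k l j * A k' l j = (if k = k' then A k l j else 0)"
  by (rule mult_of_sum_eq_1[of "\<lambda>j. A k l j"] mult_of_sum_eq_1[of "\<lambda>l. A k l j"]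
      mult_of_sum_eq_1[of "\<lambda>k. A k l j"]; use assms A_sum in simp)+

lemma G_same: "k < d \<Longrightarrow> l < d \<Longrightarrow> l' < d \<Longrightarrow> G k l k l' = (if l = l' then 1 else 0)"
  using a unfolding orthonormal_bases_def G_def by (auto simp: mult.commute)

text \<open>Parseval in the basis \<open>a k\<close> gives each vector of the basis
  \<open>a k'\<close> norm 1, and there are \<open>d\<close> of them.\<close>

lemma sum_G:
  assumes "k < d" "k' < d"
  shows "(\<Sum>l<d. \<Sum>l'<d. (cmod (G k l k' l'))\<^sup>2) = d"
proof -
  have "(\<Sum>l<d. (cmod (G k l k' l'))\<^sup>2) = 1" if "l' < d" for l'
  proof -
    have "(\<Sum>l<d. (cmod (G k l k' l'))\<^sup>2) = (\<Sum>i<d. (cmod (a k' l' i))\<^sup>2)"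
      unfolding G_def using a assms(1)
      by (intro orthonormal_Parseval) (auto simp: orthonormal_bases_def)
    moreover have "complex_of_real (\<Sum>i<d. (cmod (a k' l' i))\<^sup>2) = G k' l' k' l'"
      by (simp only: of_real_sum complex_norm_square G_def)
    then have "(\<Sum>i<d. (cmod (a k' l' i))\<^sup>2) = 1"
      using G_same[OF assms(2) that that] by (metis of_real_eq_1_iff)
    ultimately show ?thesis by simp
  qed
  then show ?thesis
    by (subst sum.swap) simp
qed

text \<open>Entries of \<open>A\<close> equal their squares, and summing them over \<open>j\<close>
  and \<open>j'\<close> gives 1, so only the overlaps \<open>G\<close> remain.\<close>

lemma sum_norm_D:
  assumes "k < d" "k' < d"
  shows "(\<Sum>j<d. \<Sum>j'<d. \<Sum>l<d. \<Sum>l'<d. (cmod (D k l j k' l' j'))\<^sup>2) = d"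
proof -
  have sq: "(real (A k l j))\<^sup>2 = real (A k l j)" if "k < d" "l < d" "j < d" for k l j
    using A_mult(1)[OF that that(3)] by (metis of_nat_mult power2_eq_square)
  have "(\<Sum>j<d. \<Sum>j'<d. \<Sum>l<d. \<Sum>l'<d. (cmod (D k l j k' l' j'))\<^sup>2) =
    (\<Sum>j<d. \<Sum>j'<d. \<Sum>l<d. \<Sum>l'<d. real (A k l j) * (real (A k' l' j') * (cmod (G k l k' l'))\<^sup>2))"
    using assms by (intro sum.cong refl) (simp add: D_eq norm_mult power_mult_distrib sq)
  also have "\<dots> = (\<Sum>l<d. \<Sum>l'<d. \<Sum>j<d. \<Sum>j'<d. real (A k l j) * (real (A k' l' j') * (cmod (G k l k' l'))\<^sup>2))"
    unfolding sum.cartesian_product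
    by (rule sum.reindex_bij_witness[where i = "\<lambda>(l, l', j, j'). (j, j', l, l')"
          and j = "\<lambda>(j, j', l, l'). (l, l', j, j')"]) auto
  also have "\<dots> = (\<Sum>l<d. \<Sum>l'<d. real (\<Sum>j<d. A k l j) * (real (\<Sum>j<d. A k' l' j) * (cmod (G k l k' l'))\<^sup>2))"
    by (simp only: of_nat_sum sum_distrib_left[symmetric] sum_distrib_right[symmetric])
  also have "\<dots> = (\<Sum>l<d. \<Sum>l'<d. (cmod (G k l k' l'))\<^sup>2)"
    using assms by (intro sum.cong refl) (simp add: A_sum)
  finally show ?thesis
    using assms by (simp add: sum_G)
qed

text \<open>For distinct \<open>k\<close> and \<open>k'\<close> the entries \<open>A k l j\<close>
  and \<open>A k' l j\<close> are never both 1. Summed over \<open>l\<close>, this gives the entries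
  of the partial trace over slots 2 and 3.\<close>

lemma ptrace3_same_l:
  assumes "k < d" "k' < d" "l < d"
  shows "ptrace3 d D k l k' l = (if k = k' then 1 else 0)"
proof -
  have "ptrace3 d D k l k' l = (\<Sum>j<d. of_nat (if k = k' then A k l j else 0) * G k l k' l)"
    unfolding ptrace3_def D_eq using assms by (intro sum.cong refl) (simp only: A_mult lessThan_iff)
  then show ?thesis
    using assms by (auto simp: sum_distrib_right[symmetric] of_nat_sum[symmetric] A_sum G_same simp del: of_nat_sum)
qed

text \<open>The diagonal blocks are the identity because vectors of one basis are
  orthogonal.\<close>

lemma ptrace3_same_k:
  assumes "k < d" "l < d" "l' < d"
  shows "ptrace3 d D k l k l' = (if l = l' then 1 else 0)"
  using ptrace3_same_l[of k k l] assms by (auto simp: ptrace3_def D_eq G_same)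

text \<open>Here the overlap factor is 1, and the blocks are the identity because each pair
  (\<open>k\<close>, \<open>l\<close>) admits only one \<open>j\<close>.\<close>

lemma ptrace2_same_k:
  assumes "k < d" "j < d" "j' < d"
  shows "ptrace2 d D k j k j' = (if j = j' then 1 else 0)"
proof -
  have "ptrace2 d D k j k j' = (\<Sum>l<d. of_nat (if j = j' then A k l j else 0))"
    unfolding ptrace2_def D_eq using assms
    by (intro sum.cong refl) (simp only: A_mult lessThan_iff G_same, simp)
  then show ?thesis
    using assms by (auto simp: of_nat_sum[symmetric] A_sum simp del: of_nat_sum)
qed

text \<open>This expresses that \<open>U_of A a\<close> is an isometry: orthogonality within each
  basis forces \<open>l = l'\<close>, and then the single 1 in each line of \<open>A\<close> forces
  \<open>j = j'\<close>.\<close>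

lemma chan1_trace_preserving: "trace_preserving d (chan1 d D)"
  unfolding trace_preserving_chan1_iff
proof (intro allI impI)
  fix l j l' j' assume lt: "l < d" "j < d" "l' < d" "j' < d"
  have "(\<Sum>k<d. D k l j k l' j') = (\<Sum>k<d. of_nat (if l = l' \<and> j = j' then A k l j else 0))"
  proof (intro sum.cong refl)
    fix k assume "k \<in> {..<d}"
    then have k: "k < d" by simp
    show "D k l j k l' j' = of_nat (if l = l' \<and> j = j' then A k l j else 0)"
    proof (cases "l = l'")
      case True
      then show ?thesis
        by (simp only: D_eq A_mult(1)[OF k lt(3,2,4)] G_same[OF k lt(3,3)]) simp
    qed (use k lt in \<open>simp add: D_eq G_same\<close>)
  qed
  then show "(\<Sum>k<d. D k l j k l' j') = (if l = l' \<and> j = j' then 1 else 0)"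
    using lt by (auto simp: of_nat_sum[symmetric] A_sum simp del: of_nat_sum)
qed

text \<open>The slices of the operator at fixed \<open>i\<close> are Kraus operators for all three
  maps, up to the arrangement of slots, so only trace preservation of the second and third map is a
  real condition.\<close>

lemma quantum_tristochastic_iff:
  "quantum_tristochastic d D \<longleftrightarrow>
    (\<forall>k<d. \<forall>j<d. \<forall>k'<d. \<forall>j'<d. ptrace2 d D k j k' j' = (if k = k' \<and> j = j' then 1 else 0)) \<and>
    (\<forall>k<d. \<forall>l<d. \<forall>k'<d. \<forall>l'<d. ptrace3 d D k l k' l' = (if k = k' \<and> l = l' then 1 else 0))"
proof -
  have "completely_positive d (chan1 d D)"
    by (rule completely_positive_chan1[where V = "\<lambda>i k l j. U_of A a k i l j"]) (simp add: dyn_def)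
  moreover have "completely_positive d (chan2 d D)"
    unfolding chan2_eq_chan1
    by (rule completely_positive_chan1[where V = "\<lambda>i l k j. U_of A a k i l j"]) (simp add: dyn_def)
  moreover have "completely_positive d (chan3 d D)"
    unfolding chan3_eq_chan1
    by (rule completely_positive_chan1[where V = "\<lambda>i j k l. U_of A a k i l j"]) (simp add: dyn_def)
  moreover have "trace_preserving d (chan2 d D) \<longleftrightarrow>
      (\<forall>k<d. \<forall>j<d. \<forall>k'<d. \<forall>j'<d. ptrace2 d D k j k' j' = (if k = k' \<and> j = j' then 1 else 0))"
    by (simp only: chan2_eq_chan1 trace_preserving_chan1_iff ptrace2_def)
  moreover have "trace_preserving d (chan3 d D) \<longleftrightarrow>
      (\<forall>k<d. \<forall>l<d. \<forall>k'<d. \<forall>l'<d. ptrace3 d D k l k' l' = (if k = k' \<and> l = l' then 1 else 0))"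
    by (simp only: chan3_eq_chan1 trace_preserving_chan1_iff ptrace3_def)
  ultimately show ?thesis
    using chan1_trace_preserving
    by (simp only: quantum_tristochastic_def quantum_channel_def simp_thms)
qed

end

section \<open>Distance of the partial traces from the identity, and the criterion\<close>

lemma sum_norm_deviation:
  fixes X :: "nat \<Rightarrow> nat \<Rightarrow> nat \<Rightarrow> nat \<Rightarrow> complex"
  assumes "\<And>k j j'. k < d \<Longrightarrow> j < d \<Longrightarrow> j' < d \<Longrightarrow> X k j k j' = (if j = j' then 1 else 0)"
  defines "S \<equiv> \<Sum>k<d. \<Sum>k'<d. \<Sum>j<d. \<Sum>j'<d. (cmod (X k j k' j'))\<^sup>2"
  shows "(real d)\<^sup>2 \<le> S"
    and "S = (real d)\<^sup>2 \<longleftrightarrow> (\<forall>k<d. \<forall>j<d. \<forall>k'<d. \<forall>j'<d. X k j k' j' = (if k = k' \<and> j = j' then 1 else 0))"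
proof -
  define E where "E = (\<lambda>k j k' j'. X k j k' j' - (if k = k' \<and> j = j' then 1 else 0))"
  define T where "T = (\<Sum>k<d. \<Sum>k'<d. \<Sum>j<d. \<Sum>j'<d. (cmod (E k j k' j'))\<^sup>2)"
  \<comment> \<open>No cross terms arise: on the diagonal blocks the deviation \<open>E\<close> is
    0, and off them the identity is 0. Hence the squared norm is that of the identity plus that of
    \<open>E\<close>.\<close>
  have "S = (\<Sum>k<d. \<Sum>k'<d. \<Sum>j<d. \<Sum>j'<d. (if k = k' \<and> j = j' then 1 else 0) + (cmod (E k j k' j'))\<^sup>2)"
    unfolding S_def E_def by (intro sum.cong refl) (auto simp: assms(1))
  also have "\<dots> = (\<Sum>k<d. \<Sum>k'<d. \<Sum>j<d. \<Sum>j'<d. if k = k' \<and> j = j' then 1 else 0) + T"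
    by (simp only: sum.distrib T_def)
  also have "(\<Sum>k<d. \<Sum>k'<d. \<Sum>j<d. \<Sum>j'<d. if k = k' \<and> j = j' then 1 else 0) =
      (\<Sum>k<d. \<Sum>k'<d. if k = k' then real d else 0)"
    by (intro sum.cong refl) auto
  also have "\<dots> = (real d)\<^sup>2"
    by (simp add: power2_eq_square)
  finally have S: "S = (real d)\<^sup>2 + T" .
  show "(real d)\<^sup>2 \<le> S"
    unfolding S T_def by (simp add: sum_nonneg)
  have "T = 0 \<longleftrightarrow> (\<forall>k<d. \<forall>k'<d. \<forall>j<d. \<forall>j'<d. E k j k' j' = 0)"
    unfolding T_def by (simp add: sum_nonneg_eq_0_iff sum_nonneg Ball_def)
  then show "S = (real d)\<^sup>2 \<longleftrightarrow> (\<forall>k<d. \<forall>j<d. \<forall>k'<d. \<forall>j'<d. X k j k' j' = (if k = k' \<and> j = j' then 1 else 0))"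
    unfolding S E_def right_minus_eq by auto
qed

theorem theorem2:
  fixes d :: nat and A :: "nat \<Rightarrow> nat \<Rightarrow> nat \<Rightarrow> nat" and a :: "nat \<Rightarrow> nat \<Rightarrow> nat \<Rightarrow> complex"
  assumes "d \<ge> 2"
    and "tristochastic_perm_tensor d A"
    and "orthonormal_bases d a"
  shows "entangling_power d (U_of A a) = 1 \<longleftrightarrow> quantum_tristochastic d (dyn d (U_of A a))"
proof -
  interpret tristochastic_unitary d A a
    by standard (fact assms)+
  define S2 where "S2 = (\<Sum>k<d. \<Sum>k'<d. \<Sum>j<d. \<Sum>j'<d. (cmod (ptrace2 d D k j k' j'))\<^sup>2)"
  define S3 where "S3 = (\<Sum>k<d. \<Sum>k'<d. \<Sum>l<d. \<Sum>l'<d. (cmod (ptrace3 d D k l k' l'))\<^sup>2)"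
  note dev2 = sum_norm_deviation[of d "ptrace2 d D", OF ptrace2_same_k, folded S2_def]
  note dev3 = sum_norm_deviation[of d "ptrace3 d D", OF ptrace3_same_k, folded S3_def]
  let ?r = "real d"
  have "(\<Sum>k<d. \<Sum>k'<d. (cmod (\<Sum>l<d. ptrace3 d D k l k' l))\<^sup>2
           + (\<Sum>l<d. \<Sum>l'<d. (cmod (ptrace3 d D k l k' l'))\<^sup>2)
           + (\<Sum>j<d. \<Sum>j'<d. (cmod (ptrace2 d D k j k' j'))\<^sup>2
           + (\<Sum>l<d. \<Sum>l'<d. (cmod (D k l j k' l' j'))\<^sup>2))) =
     (\<Sum>k<d. \<Sum>k'<d. (if k = k' then ?r\<^sup>2 else 0)) + S3 + (S2 + (\<Sum>k<d. \<Sum>k'<d. ?r))"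
    unfolding S2_def S3_def sum.distrib[symmetric]
    by (intro sum.cong refl) (simp add: ptrace3_same_l sum.distrib sum_norm_D cong: sum.cong_simp)
  also have "\<dots> = 2 * ?r^3 + S2 + S3"
    by (simp add: power2_eq_square power3_eq_cube)
  finally have ep: "entangling_power d (U_of A a) =
      (?r + 1) / (?r - 1) * (1 - (2 * ?r^3 + S2 + S3) / (?r * (?r + 1))\<^sup>2)"
    by (simp only: entangling_power_eq[OF d])
  have "?r \<ge> 2"
    using d by simp
  \<comment> \<open>Since 1 - 2 / (d + 1) = (d - 1) / (d + 1), the value 1 corresponds to mean
    purity 2 / (d + 1).\<close>
  have "entangling_power d (U_of A a) = 1 \<longleftrightarrow> (2 * ?r^3 + S2 + S3) / (?r * (?r + 1))\<^sup>2 = 2 / (?r + 1)"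
    unfolding ep using \<open>?r \<ge> 2\<close> by (simp add: divide_simps) (auto simp: algebra_simps)
  also have "\<dots> \<longleftrightarrow> 2 * ?r^3 + S2 + S3 = 2 / (?r + 1) * (?r * (?r + 1))\<^sup>2"
    using \<open>?r \<ge> 2\<close> by (subst nonzero_divide_eq_eq) auto
  also have "2 / (?r + 1) * (?r * (?r + 1))\<^sup>2 = 2 * ?r^3 + 2 * ?r\<^sup>2"
    using \<open>?r \<ge> 2\<close> by (simp add: field_simps power2_eq_square power3_eq_cube)
  \<comment> \<open>Both \<open>S2\<close> and \<open>S3\<close> are at least d^2, so their sum is 2
    d^2 only if each bound is attained.\<close>
  also have "2 * ?r^3 + S2 + S3 = 2 * ?r^3 + 2 * ?r\<^sup>2 \<longleftrightarrow> S2 = ?r\<^sup>2 \<and> S3 = ?r\<^sup>2"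
    using dev2(1) dev3(1) by auto
  finally show ?thesis
    by (simp only: dev2(2) dev3(2) quantum_tristochastic_iff)
qed

end
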